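(* Let $(\Omega,\mathcal{B},\mu)$ be a $\sigma$-finite measure space with $\mu(\Omega)=\infty$, let $T:\Omega\to\Omega$ be a conservative, invertible, ergodic, measure-preserving transformation, let $f:\Omega\to\mathbb{R}$ be bounded and measurable, and for $\omega\in\Omega$ let $H_\omega$ be the bounded self-adjoint operator on $\ell^2(\mathbb{Z})$ given by $(H_\omega u)_n=u_{n-1}+u_{n+1}+f(T^n\omega)u_n$. Then there exists $\Omega_*\subseteq\Omega$ of full $\mu$-measure (i.e. $\mu(\Omega\setminus\Omega_* )=0$) such that, for every continuous function $g:\mathbb{R}\to\mathbb{R}$, there exist constants $\overline{I}^{+}(g),\overline{I}^{-}(g),\underline{I}^{+}(g),\underline{I}^{-}(g)$ such that for all $\omega\in\Omega_*$ and each choice of sign $\pm$, $$\underline{I}^\pm(g)=\liminf_{N\to\infty}\int g\,dk_{\omega,N}^\pm=\liminf_{N\to\infty}\int g\,d\tilde k_{\omega,N}^\pm,$$ $$\overline{I}^\pm(g)=\limsup_{N\to\infty}\int g\,dk_{\omega,N}^\pm=\limsup_{N\to\infty}\int g\,d\tilde k_{\omega,N}^\pm.$$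
   Context: A measurable transformation $T$ is: invertible if it is bijective and $T^{-1}$ is measurable; measure-preserving if $\mu(T^{-1}E)=\mu(E)$ for all $E\in\mathcal{B}$; ergodic if $T^{-1}E=E$ (with $E\in\mathcal{B}$) implies $\mu(E)=0$ or $\mu(\Omega\setminus E)=0$; conservative if there is no $W\in\mathcal{B}$ with $\mu(W)>0$ such that the sets $T^{-n}W$, $n\ge 0$, are pairwise disjoint. For $N\in\mathbb{N}$ let $P_{N,+}:\ell^2(\mathbb{Z})\to\ell^2(\{0,\dots,N-1\})$ and $P_{N,-}:\ell^2(\mathbb{Z})\to\ell^2(\{-N,\dots,-1\})$ be the canonical projections (restriction maps). The probability measures $dk_{\omega,N}^\pm$ and $d\tilde k_{\omega,N}^\pm$ on $\mathbb{R}$ are defined by $$\int g\,dk_{\omega,N}^\pm=\frac1N\operatorname{tr}\left(P_{N,\pm}\,g(H_\omega)\,P_{N,\pm}^*\right),\qquad \int g\,d\tilde k_{\omega,N}^\pm=\frac1N\operatorname{tr}\left(g\left(P_{N,\pm}H_\omega P_{N,\pm}^*\right)\right)$$ for each continuous function $g$. *)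

theory Defs
  imports "HOL-Probability.Probability" "HOL-Computational_Algebra.Polynomial"
begin

typedef ell2 = "{u :: int \<Rightarrow> complex. (\<lambda>n. (cmod (u n))\<^sup>2) summable_on UNIV}"
  morphisms coord Abs_ell2
  by (rule exI[of _ "\<lambda>_. 0"]) simp

setup_lifting type_definition_ell2

lemma ell2_summable_add:
  fixes u v :: "int \<Rightarrow> complex"
  assumes "(\<lambda>n. (cmod (u n))\<^sup>2) summable_on UNIV" "(\<lambda>n. (cmod (v n))\<^sup>2) summable_on UNIV"
  shows "(\<lambda>n. (cmod (u n + v n))\<^sup>2) summable_on UNIV"
proof (rule summable_on_comparison_test)
  show "(\<lambda>n. 2 * (cmod (u n))\<^sup>2 + 2 * (cmod (v n))\<^sup>2) summable_on UNIV"
    using assms by (intro summable_on_add summable_on_cmult_right)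
  fix n
  have "(cmod (u n + v n))\<^sup>2 \<le> (cmod (u n) + cmod (v n))\<^sup>2"
    by (simp add: norm_triangle_ineq power_mono)
  also have "\<dots> \<le> 2 * (cmod (u n))\<^sup>2 + 2 * (cmod (v n))\<^sup>2"
    using sum_squares_bound[of "cmod (u n)" "cmod (v n)"] by (simp add: power2_sum)
  finally show "(cmod (u n + v n))\<^sup>2 \<le> 2 * (cmod (u n))\<^sup>2 + 2 * (cmod (v n))\<^sup>2" .
qed auto

lemma ell2_summable_mult:
  fixes u m :: "int \<Rightarrow> complex"
  assumes "(\<lambda>n. (cmod (u n))\<^sup>2) summable_on UNIV" "\<And>n. cmod (m n) \<le> K"
  shows "(\<lambda>n. (cmod (m n * u n))\<^sup>2) summable_on UNIV"
proof (rule summable_on_comparison_test)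
  show "(\<lambda>n. K\<^sup>2 * (cmod (u n))\<^sup>2) summable_on UNIV"
    using assms by (intro summable_on_cmult_right)
  show "(cmod (m n * u n))\<^sup>2 \<le> K\<^sup>2 * (cmod (u n))\<^sup>2" for n
    using assms(2)[of n] by (simp add: norm_mult power_mult_distrib mult_right_mono power_mono)
qed auto

lemma ell2_summable_shift:
  fixes u :: "int \<Rightarrow> complex"
  assumes "(\<lambda>n. (cmod (u n))\<^sup>2) summable_on UNIV"
  shows "(\<lambda>n. (cmod (u (n + k)))\<^sup>2) summable_on UNIV"
proof -
  have "bij_betw (\<lambda>n::int. n + k) UNIV UNIV"
    by (rule bij_betw_byWitness[of _ "\<lambda>n. n - k"]) auto
  from summable_on_reindex_bij_betw[OF this, of "\<lambda>n. (cmod (u n))\<^sup>2"] assms show ?thesis by simp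
qed

lemma ell2_summable_inner:
  fixes u v :: "int \<Rightarrow> complex"
  assumes "(\<lambda>n. (cmod (u n))\<^sup>2) summable_on UNIV" "(\<lambda>n. (cmod (v n))\<^sup>2) summable_on UNIV"
  shows "(\<lambda>n. inner (u n) (v n)) summable_on UNIV"
proof -
  have eq: "inner (u n) (v n) =
      (1/2) * (cmod (u n + v n))\<^sup>2 + (- (1/2) * (cmod (u n))\<^sup>2 + - (1/2) * (cmod (v n))\<^sup>2)" for n
    by (simp add: power2_norm_eq_inner inner_add_left inner_add_right inner_commute field_simps)
  show ?thesis unfolding eq
    by (intro summable_on_add summable_on_cmult_right ell2_summable_add assms)
qed

instantiation ell2 :: real_vector
begin

lift_definition zero_ell2 :: ell2 is "\<lambda>_. 0" by simp

lift_definition plus_ell2 :: "ell2 \<Rightarrow> ell2 \<Rightarrow> ell2" is "\<lambda>u v n. u n + v n"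
  by (rule ell2_summable_add)

lift_definition uminus_ell2 :: "ell2 \<Rightarrow> ell2" is "\<lambda>u n. - u n" by simp

lift_definition minus_ell2 :: "ell2 \<Rightarrow> ell2 \<Rightarrow> ell2" is "\<lambda>u v n. u n - v n"
  using ell2_summable_add[of _ "\<lambda>n. - _ n"] by simp

lift_definition scaleR_ell2 :: "real \<Rightarrow> ell2 \<Rightarrow> ell2" is "\<lambda>r u n. complex_of_real r * u n"
  by (rule ell2_summable_mult) auto

instance
proof
  fix u v w :: ell2 and a b :: real
  show "u + v + w = u + (v + w)" by transfer (simp add: add.assoc)
  show "u + v = v + u" by transfer (simp add: add.commute)
  show "0 + u = u" by transfer simp
  show "- u + u = 0" by transfer simp
  show "u - v = u + - v" by transfer simp
  show "a *\<^sub>R (u + v) = a *\<^sub>R u + a *\<^sub>R v" by transfer (simp add: algebra_simps)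
  show "(a + b) *\<^sub>R u = a *\<^sub>R u + b *\<^sub>R u" by transfer (simp add: algebra_simps)
  show "a *\<^sub>R b *\<^sub>R u = (a * b) *\<^sub>R u" by transfer (simp add: algebra_simps)
  show "1 *\<^sub>R u = u" by transfer simp
qed

end

instantiation ell2 :: real_inner
begin

text \<open>The real part of the Hermitian inner product; it induces the Hilbert space norm
  (lemma \<open>norm_ell2\<close> below).\<close>
lift_definition inner_ell2 :: "ell2 \<Rightarrow> ell2 \<Rightarrow> real"
  is "\<lambda>u v. \<Sum>\<^sub>\<infinity>n. inner (u n) (v n)" .

definition norm_ell2 :: "ell2 \<Rightarrow> real" where "norm_ell2 u = sqrt (inner u u)"

definition dist_ell2 :: "ell2 \<Rightarrow> ell2 \<Rightarrow> real" where "dist_ell2 u v = norm (u - v)"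

definition sgn_ell2 :: "ell2 \<Rightarrow> ell2" where "sgn_ell2 u = u /\<^sub>R norm u"

definition uniformity_ell2 :: "(ell2 \<times> ell2) filter"
  where "uniformity_ell2 = (INF e\<in>{0 <..}. principal {(x, y). dist x y < e})"

definition open_ell2 :: "ell2 set \<Rightarrow> bool"
  where "open_ell2 S = (\<forall>x\<in>S. \<forall>\<^sub>F (x', y) in uniformity. x' = x \<longrightarrow> y \<in> S)"

instance
proof
  fix u v w :: ell2 and a :: real
  show "sgn u = u /\<^sub>R norm u" by (rule sgn_ell2_def)
  show "dist u v = norm (u - v)" by (rule dist_ell2_def)
  show "uniformity = (INF e\<in>{0 <..}. principal {(x :: ell2, y). dist x y < e})"
    by (rule uniformity_ell2_def)
  show "open S \<longleftrightarrow> (\<forall>x\<in>S. \<forall>\<^sub>F (x', y) in uniformity. x' = x \<longrightarrow> y \<in> S)" for S :: "ell2 set"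
    by (simp add: open_ell2_def)
  show "inner u v = inner v u" by transfer (simp add: inner_commute)
  show "inner (u + v) w = inner u w + inner v w"
    by transfer (simp add: inner_add_left infsum_add ell2_summable_inner)
  show "inner (a *\<^sub>R u) v = a * inner u v"
  proof transfer
    fix u v :: "int \<Rightarrow> complex" and a :: real
    have "inner (complex_of_real a * u n) (v n) = a * inner (u n) (v n)" for n
      by (simp add: inner_complex_def algebra_simps)
    then show "(\<Sum>\<^sub>\<infinity>n. inner (complex_of_real a * u n) (v n)) = a * (\<Sum>\<^sub>\<infinity>n. inner (u n) (v n))"
      by (simp add: infsum_cmult_right')
  qed
  show "0 \<le> inner u u" by transfer (simp add: infsum_nonneg)
  show "inner u u = 0 \<longleftrightarrow> u = 0"
  proof transfer
    fix u :: "int \<Rightarrow> complex"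
    assume u: "(\<lambda>n. (cmod (u n))\<^sup>2) summable_on UNIV"
    show "(\<Sum>\<^sub>\<infinity>n. inner (u n) (u n)) = 0 \<longleftrightarrow> u = (\<lambda>_. 0)"
    proof
      assume "(\<Sum>\<^sub>\<infinity>n. inner (u n) (u n)) = 0"
      then have "inner (u n) (u n) = 0" for n
        by (intro nonneg_infsum_le_0D[where A = UNIV])
           (auto intro: ell2_summable_inner u)
      then show "u = (\<lambda>_. 0)" by auto
    qed simp
  qed
  show "norm u = sqrt (inner u u)" by (rule norm_ell2_def)
qed

end

lemma norm_ell2: "norm u = sqrt (\<Sum>\<^sub>\<infinity>n. (cmod (coord u n))\<^sup>2)"
  by (simp add: norm_eq_sqrt_inner inner_ell2.rep_eq power2_norm_eq_inner)

lemma coord_Abs_ell2: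
  "(\<lambda>n. (cmod (u n))\<^sup>2) summable_on UNIV \<Longrightarrow> coord (Abs_ell2 u) = u"
  by (simp add: Abs_ell2_inverse)

lemma coord_summable: "(\<lambda>n. (cmod (coord u n))\<^sup>2) summable_on UNIV"
  using coord by simp

lift_definition cscale :: "complex \<Rightarrow> ell2 \<Rightarrow> ell2" is "\<lambda>z u n. z * u n"
  by (rule ell2_summable_mult) auto

lemma coord_simps [simp]:
  "coord 0 n = 0" "coord (u + v) n = coord u n + coord v n"
  "coord (u - v) n = coord u n - coord v n" "coord (- u) n = - coord u n"
  "coord (r *\<^sub>R u) n = complex_of_real r * coord u n" "coord (cscale z u) n = z * coord u n"
  by (simp_all add: zero_ell2.rep_eq plus_ell2.rep_eq minus_ell2.rep_eq uminus_ell2.rep_eq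
      scaleR_ell2.rep_eq cscale.rep_eq)

lemma ell2_eqI: "(\<And>n. coord u n = coord v n) \<Longrightarrow> u = v"
  by (metis coord_inject ext)

lemma sum_coord_le_norm:
  assumes "finite F"
  shows "(\<Sum>n\<in>F. (cmod (coord u n))\<^sup>2) \<le> (norm u)\<^sup>2"
proof -
  have "(\<Sum>n\<in>F. (cmod (coord u n))\<^sup>2) \<le> (\<Sum>\<^sub>\<infinity>n. (cmod (coord u n))\<^sup>2)"
    using assms by (intro finite_sum_le_infsum coord_summable) auto
  then show ?thesis by (simp add: norm_ell2 infsum_nonneg)
qed

lemma cmod_coord_le_norm: "cmod (coord u n) \<le> norm u"
  using sum_coord_le_norm[of "{n}" u] by (simp add: power2_le_iff_abs_le)

instance ell2 :: banach
proof
  fix X :: "nat \<Rightarrow> ell2"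
  assume X: "Cauchy X"
  have "Cauchy (\<lambda>k. coord (X k) n)" for n
  proof (rule CauchyI)
    fix e :: real assume "0 < e"
    from CauchyD[OF X this] obtain K where K: "\<forall>j\<ge>K. \<forall>k\<ge>K. norm (X j - X k) < e" by blast
    have "cmod (coord (X j) n - coord (X k) n) < e" if "j \<ge> K" "k \<ge> K" for j k
    proof -
      have "cmod (coord (X j - X k) n) < e"
        using K that cmod_coord_le_norm order.strict_trans1 by blast
      then show ?thesis by (simp only: coord_simps)
    qed
    then show "\<exists>K. \<forall>j\<ge>K. \<forall>k\<ge>K. cmod (coord (X j) n - coord (X k) n) < e" by blast
  qed
  then have "\<exists>l. (\<lambda>k. coord (X k) n) \<longlonglongrightarrow> l" for n
    by (simp add: Cauchy_convergent_iff convergent_def)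
  then obtain v where v: "\<And>n. (\<lambda>k. coord (X k) n) \<longlonglongrightarrow> v n" by metis
  have tail: "(\<Sum>n\<in>F. (cmod (coord (X j) n - v n))\<^sup>2) \<le> e\<^sup>2"
    if K: "\<forall>j\<ge>K. \<forall>k\<ge>K. norm (X j - X k) < e" and j: "j \<ge> K" and F: "finite F" for e K j F
  proof (rule LIMSEQ_le_const2)
    show "(\<lambda>k. \<Sum>n\<in>F. (cmod (coord (X j) n - coord (X k) n))\<^sup>2)
        \<longlonglongrightarrow> (\<Sum>n\<in>F. (cmod (coord (X j) n - v n))\<^sup>2)"
      by (intro tendsto_intros v)
    have "(\<Sum>n\<in>F. (cmod (coord (X j) n - coord (X k) n))\<^sup>2) \<le> e\<^sup>2" if "k \<ge> K" for k
    proof -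
      have "(\<Sum>n\<in>F. (cmod (coord (X j) n - coord (X k) n))\<^sup>2) \<le> (norm (X j - X k))\<^sup>2"
        using sum_coord_le_norm[OF F, of "X j - X k"] by simp
      moreover have "norm (X j - X k) < e" using K j that by blast
      then have "(norm (X j - X k))\<^sup>2 \<le> e\<^sup>2" by (intro power_mono) simp_all
      ultimately show ?thesis by simp
    qed
    then show "\<exists>N. \<forall>k\<ge>N. (\<Sum>n\<in>F. (cmod (coord (X j) n - coord (X k) n))\<^sup>2) \<le> e\<^sup>2" by blast
  qed
  have diff: "(\<lambda>n. (cmod (coord (X j) n - v n))\<^sup>2) summable_on UNIV"
    if "\<forall>j\<ge>K. \<forall>k\<ge>K. norm (X j - X k) < e" "j \<ge> K" for e K j
    by (rule nonneg_bdd_above_summable_on) (auto intro!: bdd_aboveI2 tail[OF that])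
  from CauchyD[OF X, of 1] obtain K where K: "\<forall>j\<ge>K. \<forall>k\<ge>K. norm (X j - X k) < 1" by auto
  have "(\<lambda>n. (cmod (coord (X K) n + - (coord (X K) n - v n)))\<^sup>2) summable_on UNIV"
    using diff[OF K, of K] by (intro ell2_summable_add coord_summable) (simp_all add: norm_minus_commute)
  then have cv: "coord (Abs_ell2 v) = v" by (intro coord_Abs_ell2) simp
  have "X \<longlonglongrightarrow> Abs_ell2 v"
  proof (rule LIMSEQ_I)
    fix e :: real assume e: "0 < e"
    then have "0 < e / 2" by simp
    from CauchyD[OF X this] obtain K where K: "\<forall>j\<ge>K. \<forall>k\<ge>K. norm (X j - X k) < e / 2" by blast
    have "norm (X j - Abs_ell2 v) < e" if j: "j \<ge> K" for j
    proof -
      have "(\<Sum>\<^sub>\<infinity>n. (cmod (coord (X j) n - v n))\<^sup>2) \<le> (e / 2)\<^sup>2"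
        by (rule infsum_le_finite_sums[OF diff[OF K j]]) (rule tail[OF K j])
      then have "sqrt (\<Sum>\<^sub>\<infinity>n. (cmod (coord (X j) n - v n))\<^sup>2) \<le> e / 2"
        using e by (intro real_le_lsqrt) simp_all
      then have "norm (X j - Abs_ell2 v) \<le> e / 2"
        by (simp only: norm_ell2 coord_simps cv)
      then show ?thesis using e by simp
    qed
    then show "\<exists>K. \<forall>j\<ge>K. norm (X j - Abs_ell2 v) < e" by blast
  qed
  then show "convergent X" by (auto simp: convergent_def)
qed

lift_definition delta :: "int \<Rightarrow> ell2" is "\<lambda>k n. if n = k then 1 else 0"
proof -
  fix k :: int
  have "(\<lambda>n. (cmod (if n = k then 1 else 0))\<^sup>2) summable_on UNIV
      \<longleftrightarrow> (\<lambda>n. (cmod (if n = k then 1 else 0))\<^sup>2) summable_on {k}"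
    by (intro summable_on_cong_neutral) auto
  then show "(\<lambda>n. (cmod (if n = k then 1 else 0))\<^sup>2) summable_on UNIV"
    by simp
qed

text \<open>For a set \<open>S\<close> of integers, \<open>\<ell>\<^sup>2(S)\<close> is identified with the closed subspace of the
  sequences supported in \<open>S\<close>.  Under this identification the restriction map onto \<open>\<ell>\<^sup>2(S)\<close> is
  \<open>proj S\<close> and its adjoint is the inclusion, so that \<open>P A P\<^sup>*\<close> is
  \<open>proj S o\<^sub>L A o\<^sub>L proj S\<close> acting on \<open>\<ell>\<^sup>2(S)\<close>.\<close>

definition ell2_on :: "int set \<Rightarrow> ell2 set" where
  "ell2_on S = {u. \<forall>n. n \<notin> S \<longrightarrow> coord u n = 0}"

definition proj :: "int set \<Rightarrow> ell2 \<Rightarrow>\<^sub>L ell2" where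
  "proj S = Blinfun (\<lambda>u. Abs_ell2 (\<lambda>n. if n \<in> S then coord u n else 0))"

definition compress :: "int set \<Rightarrow> (ell2 \<Rightarrow>\<^sub>L ell2) \<Rightarrow> (ell2 \<Rightarrow>\<^sub>L ell2)" where
  "compress S A = proj S o\<^sub>L A o\<^sub>L proj S"

definition trace_on :: "int set \<Rightarrow> (ell2 \<Rightarrow>\<^sub>L ell2) \<Rightarrow> complex" where
  "trace_on S A = (\<Sum>n\<in>S. coord (blinfun_apply A (delta n)) n)"

text \<open>The spectrum of the operator on \<open>\<ell>\<^sup>2(S)\<close> given by the restriction of \<open>A\<close>, where \<open>A\<close> is
  complex-linear and maps \<open>\<ell>\<^sup>2(S)\<close> into itself.  The resolvent \<open>R\<close> is only required to be bounded
  and real-linear, but an inverse of a complex-linear map is automatically complex-linear, and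
  its values outside \<open>\<ell>\<^sup>2(S)\<close> play no role.\<close>
definition spectrum_on :: "int set \<Rightarrow> (ell2 \<Rightarrow>\<^sub>L ell2) \<Rightarrow> complex set" where
  "spectrum_on S A = {z. \<not> (\<exists>R :: ell2 \<Rightarrow>\<^sub>L ell2. \<forall>u\<in>ell2_on S.
     blinfun_apply R u \<in> ell2_on S \<and>
     blinfun_apply R (blinfun_apply A u - cscale z u) = u \<and>
     blinfun_apply A (blinfun_apply R u) - cscale z (blinfun_apply R u) = u)}"

definition poly_op :: "real poly \<Rightarrow> (ell2 \<Rightarrow>\<^sub>L ell2) \<Rightarrow> (ell2 \<Rightarrow>\<^sub>L ell2)" where
  "poly_op p A = (\<Sum>i\<le>degree p. coeff p i *\<^sub>R ((((o\<^sub>L) A) ^^ i) id_blinfun))"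

text \<open>Continuous functional calculus for a bounded self-adjoint operator \<open>A\<close> on \<open>\<ell>\<^sup>2(S)\<close> and a
  continuous real function \<open>g\<close>: the operator \<open>g(A)\<close> is the norm limit of \<open>p\<^sub>k(A)\<close> for all
  sequences of real polynomials \<open>p\<^sub>k\<close> converging to \<open>g\<close> uniformly on the spectrum (which is real
  as \<open>A\<close> is self-adjoint).  Composing with \<open>proj S\<close> restricts the polynomials, whose constant
  term acts as a multiple of the identity of the whole space, to \<open>\<ell>\<^sup>2(S)\<close>.\<close>
definition cfc_on :: "int set \<Rightarrow> (ell2 \<Rightarrow>\<^sub>L ell2) \<Rightarrow> (real \<Rightarrow> real) \<Rightarrow> (ell2 \<Rightarrow>\<^sub>L ell2)" where
  "cfc_on S A g = (THE B. \<forall>p :: nat \<Rightarrow> real poly.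
     uniform_limit {x. complex_of_real x \<in> spectrum_on S A} (\<lambda>k. poly (p k)) g sequentially \<longrightarrow>
     (\<lambda>k. poly_op (p k) A o\<^sub>L proj S) \<longlonglongrightarrow> B)"

datatype sign = Plus | Minus

fun window :: "sign \<Rightarrow> nat \<Rightarrow> int set" where
  "window Plus N = {0..<int N}"
| "window Minus N = {- int N..<0}"

text \<open>The Borel probability measure on the line representing a functional on the continuous
  functions.  Values are complex because the functionals below are traces.\<close>
definition representing_measure :: "((real \<Rightarrow> real) \<Rightarrow> complex) \<Rightarrow> real measure" where
  "representing_measure L = (THE \<kappa>. prob_space \<kappa> \<and> sets \<kappa> = sets borel \<and>
     (\<forall>g. continuous_on UNIV g \<longrightarrow>
        integrable \<kappa> g \<and> complex_of_real (\<integral>x. g x \<partial>\<kappa>) = L g))"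

definition dk :: "(ell2 \<Rightarrow>\<^sub>L ell2) \<Rightarrow> sign \<Rightarrow> nat \<Rightarrow> real measure" where
  "dk H s N = representing_measure
     (\<lambda>g. 1 / of_nat N * trace_on (window s N) (compress (window s N) (cfc_on UNIV H g)))"

definition dk_tilde :: "(ell2 \<Rightarrow>\<^sub>L ell2) \<Rightarrow> sign \<Rightarrow> nat \<Rightarrow> real measure" where
  "dk_tilde H s N = representing_measure
     (\<lambda>g. 1 / of_nat N * trace_on (window s N) (cfc_on (window s N) (compress (window s N) H) g))"

definition invertible_map :: "'a measure \<Rightarrow> ('a \<Rightarrow> 'a) \<Rightarrow> bool" where
  "invertible_map M T \<longleftrightarrow> T \<in> measurable M M \<and> bij_betw T (space M) (space M) \<and>
     the_inv_into (space M) T \<in> measurable M M"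

definition preserves_measure :: "'a measure \<Rightarrow> ('a \<Rightarrow> 'a) \<Rightarrow> bool" where
  "preserves_measure M T \<longleftrightarrow> T \<in> measurable M M \<and>
     (\<forall>E\<in>sets M. emeasure M (T -` E \<inter> space M) = emeasure M E)"

definition ergodic_map :: "'a measure \<Rightarrow> ('a \<Rightarrow> 'a) \<Rightarrow> bool" where
  "ergodic_map M T \<longleftrightarrow> T \<in> measurable M M \<and>
     (\<forall>E\<in>sets M. T -` E \<inter> space M = E \<longrightarrow>
        emeasure M E = 0 \<or> emeasure M (space M - E) = 0)"

definition conservative_map :: "'a measure \<Rightarrow> ('a \<Rightarrow> 'a) \<Rightarrow> bool" where
  "conservative_map M T \<longleftrightarrow> T \<in> measurable M M \<and>
     \<not> (\<exists>W\<in>sets M. emeasure M W > 0 \<and> disjoint_family (\<lambda>n. (T ^^ n) -` W \<inter> space M))"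

definition int_iterate :: "'a measure \<Rightarrow> ('a \<Rightarrow> 'a) \<Rightarrow> int \<Rightarrow> 'a \<Rightarrow> 'a" where
  "int_iterate M T n =
     (if n \<ge> 0 then T ^^ nat n else (the_inv_into (space M) T) ^^ nat (- n))"

text \<open>Meaningful for bounded \<open>V\<close> only: see \<open>coord_schroedinger\<close> below.\<close>
definition schroedinger :: "(int \<Rightarrow> real) \<Rightarrow> ell2 \<Rightarrow>\<^sub>L ell2" where
  "schroedinger V = Blinfun (\<lambda>u. Abs_ell2
     (\<lambda>n. coord u (n - 1) + coord u (n + 1) + complex_of_real (V n) * coord u n))"

definition hamiltonian :: "'a measure \<Rightarrow> ('a \<Rightarrow> 'a) \<Rightarrow> ('a \<Rightarrow> real) \<Rightarrow> 'a \<Rightarrow> ell2 \<Rightarrow>\<^sub>L ell2" where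
  "hamiltonian M T f \<omega> = schroedinger (\<lambda>n. f (int_iterate M T n \<omega>))"

lemma bounded_linear_mult_shift:
  assumes "\<And>n. cmod (m n) \<le> K"
  shows "bounded_linear (\<lambda>u. Abs_ell2 (\<lambda>n. m n * coord u (n + k)))" (is "bounded_linear ?F")
proof (rule bounded_linear_intro)
  have K: "0 \<le> K" using assms[of 0] norm_ge_zero order_trans by blast
  have s: "(\<lambda>n. (cmod (m n * coord u (n + k)))\<^sup>2) summable_on UNIV" for u
    by (rule ell2_summable_mult[OF ell2_summable_shift[OF coord_summable] assms])
  have c: "coord (?F u) n = m n * coord u (n + k)" for u n
    by (simp add: coord_Abs_ell2[OF s])
  show "?F (u + v) = ?F u + ?F v" for u v
    by (rule ell2_eqI) (simp only: c, simp only: coord_simps, simp only: c distrib_left)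
  show "?F (r *\<^sub>R u) = r *\<^sub>R ?F u" for r u
    by (rule ell2_eqI) (simp only: c, simp only: coord_simps, simp only: c mult.left_commute)
  have bij: "bij_betw (\<lambda>n::int. n + k) UNIV UNIV"
    by (rule bij_betw_byWitness[of _ "\<lambda>n. n - k"]) auto
  show "norm (?F u) \<le> norm u * K" for u
  proof -
    have "(\<Sum>\<^sub>\<infinity>n. (cmod (m n * coord u (n + k)))\<^sup>2) \<le> (\<Sum>\<^sub>\<infinity>n. K\<^sup>2 * (cmod (coord u (n + k)))\<^sup>2)"
    proof (rule infsum_mono[OF s])
      show "(\<lambda>n. K\<^sup>2 * (cmod (coord u (n + k)))\<^sup>2) summable_on UNIV"
        by (intro summable_on_cmult_right ell2_summable_shift coord_summable)
      show "(cmod (m n * coord u (n + k)))\<^sup>2 \<le> K\<^sup>2 * (cmod (coord u (n + k)))\<^sup>2" for n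
        using assms[of n] by (simp add: norm_mult power_mult_distrib mult_right_mono power_mono)
    qed
    also have "\<dots> = K\<^sup>2 * (\<Sum>\<^sub>\<infinity>n. (cmod (coord u n))\<^sup>2)"
      using infsum_reindex_bij_betw[OF bij, of "\<lambda>n. (cmod (coord u n))\<^sup>2"]
      by (simp add: infsum_cmult_right')
    finally have "norm (?F u) \<le> sqrt (K\<^sup>2 * (\<Sum>\<^sub>\<infinity>n. (cmod (coord u n))\<^sup>2))"
      by (simp add: norm_ell2 c)
    then show ?thesis using K by (simp add: norm_ell2 real_sqrt_mult mult.commute)
  qed
qed

lemma coord_proj: "coord (blinfun_apply (proj S) u) n = (if n \<in> S then coord u n else 0)"
proof -
  let ?m = "\<lambda>n. if n \<in> S then 1 else (0 :: complex)"
  have eq: "(\<lambda>n. if n \<in> S then coord v n else 0) = (\<lambda>n. ?m n * coord v (n + 0))" for v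
    by auto
  have m: "cmod (?m n) \<le> 1" for n by simp
  have "coord (blinfun_apply (proj S) u) n = ?m n * coord u (n + 0)"
    unfolding proj_def eq
    by (subst bounded_linear_Blinfun_apply[OF bounded_linear_mult_shift[OF m]],
        subst coord_Abs_ell2[OF ell2_summable_mult[OF ell2_summable_shift[OF coord_summable] m]])
       (rule refl)
  then show ?thesis by simp
qed

lemma coord_schroedinger:
  assumes "bounded (range V)"
  shows "coord (blinfun_apply (schroedinger V) u) n =
    coord u (n - 1) + coord u (n + 1) + complex_of_real (V n) * coord u n"
proof -
  from assms obtain K where "\<forall>x\<in>range V. norm x \<le> K" unfolding bounded_iff by blast
  then have K: "cmod (complex_of_real (V n)) \<le> K" for n by simp
  have one: "cmod 1 \<le> 1" by simp
  let ?F = "\<lambda>m k u. Abs_ell2 (\<lambda>n. m n * coord u (n + k))"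
  let ?V = "\<lambda>n. complex_of_real (V n)"
  let ?G = "\<lambda>u. ?F (\<lambda>_. 1) (-1) u + ?F (\<lambda>_. 1) 1 u + ?F ?V 0 u"
  let ?w = "\<lambda>u n. coord u (n - 1) + coord u (n + 1) + ?V n * coord u n"
  have cG: "coord (?G u) = ?w u" for u
    using coord_Abs_ell2[OF ell2_summable_mult[OF ell2_summable_shift[OF coord_summable, of u "-1"] one]]
      coord_Abs_ell2[OF ell2_summable_mult[OF ell2_summable_shift[OF coord_summable, of u 1] one]]
      coord_Abs_ell2[OF ell2_summable_mult[OF ell2_summable_shift[OF coord_summable, of u 0] K]]
    by (intro ext) simp
  have G: "(\<lambda>u. Abs_ell2 (?w u)) = ?G"
  proof
    fix u
    show "Abs_ell2 (?w u) = ?G u" unfolding cG[symmetric] by (rule coord_inverse)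
  qed
  have "bounded_linear ?G"
    by (intro bounded_linear_add bounded_linear_mult_shift[OF one] bounded_linear_mult_shift[OF K])
  then have "blinfun_apply (schroedinger V) u = ?G u"
    unfolding schroedinger_def G by (simp only: bounded_linear_Blinfun_apply)
  then show ?thesis by (simp only: cG)
qed

end

theory Submission
  imports Defs "HOL-Computational_Algebra.Fundamental_Theorem_Algebra"
begin

text \<open>For a polynomial \<open>p\<close> the matrix element of \<open>p(H\<^sub>\<omega>)\<close> at \<open>\<delta>\<^sub>n\<close> depends only on the
  potential near \<open>n\<close>.  Hence restricting \<open>H\<^sub>\<omega>\<close> to a window changes boundedly many diagonal
  entries, which the factor \<open>1/N\<close> makes negligible, and replacing \<open>\<omega>\<close> by \<open>T \<omega>\<close> merely moves the
  window by one site.  The lower and upper limits for \<open>p\<close> are therefore \<open>T\<close>-invariant measurable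
  functions of \<open>\<omega>\<close>, so constant almost everywhere by ergodicity.  The countably many polynomials
  with rational coefficients give one exceptional null set, and since all spectra lie in a common
  compact interval, uniform approximation transfers the statement to every continuous \<open>g\<close>.

  That the integrals against the measures are the traces rests on two facts.
  The bound \<open>\<parallel>p(A)\<parallel> \<le> sup |p|\<close> over the spectrum of a symmetric \<open>A\<close> holds since \<open>p\<^sup>2 - \<parallel>p(A)\<parallel>\<^sup>2\<close>
  would otherwise have no zero in the spectrum, making \<open>p(A)\<^sup>2 - \<parallel>p(A)\<parallel>\<^sup>2\<close> bounded below, which is
  impossible.  The representing measure is a weak limit of discrete measures given by Bernstein
  polynomials, and it is unique because its characteristic function is determined.\<close>

subsection \<open>Polynomials of operators\<close>

lemma funpow_compose_blinfun_apply:
  fixes A :: "'a::real_normed_vector \<Rightarrow>\<^sub>L 'a"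
  shows "blinfun_apply ((((o\<^sub>L) A) ^^ i) id_blinfun) u = (blinfun_apply A ^^ i) u"
  by (induction i) simp_all

text \<open>Any upper bound on the degree may serve as the summation range, so that polynomials of
  different degrees can be compared coefficient by coefficient.\<close>

lemma poly_op_apply_extend:
  assumes "degree p \<le> n"
  shows "blinfun_apply (poly_op p A) u = (\<Sum>i\<le>n. coeff p i *\<^sub>R (blinfun_apply A ^^ i) u)"
proof -
  have "blinfun_apply (poly_op p A) u = (\<Sum>i\<le>degree p. coeff p i *\<^sub>R (blinfun_apply A ^^ i) u)"
    by (simp add: poly_op_def blinfun.sum_left blinfun.scaleR_left funpow_compose_blinfun_apply)
  also have "\<dots> = (\<Sum>i\<le>n. coeff p i *\<^sub>R (blinfun_apply A ^^ i) u)"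
    using assms by (intro sum.mono_neutral_left) (auto simp: coeff_eq_0)
  finally show ?thesis .
qed

lemma poly_op_apply:
  "blinfun_apply (poly_op p A) u = (\<Sum>i\<le>degree p. coeff p i *\<^sub>R (blinfun_apply A ^^ i) u)"
  by (rule poly_op_apply_extend) simp

lemma poly_op_0 [simp]: "poly_op 0 A = 0"
  by (rule blinfun_eqI) (simp add: poly_op_apply)

text \<open>Horner's scheme for operators; the inductions over polynomials below all run through
  this recursion.\<close>

lemma poly_op_pCons [simp]:
  "blinfun_apply (poly_op (pCons a p) A) u = a *\<^sub>R u + blinfun_apply A (blinfun_apply (poly_op p A) u)"
proof -
  have "blinfun_apply (poly_op (pCons a p) A) u
      = (\<Sum>i\<le>Suc (degree p). coeff (pCons a p) i *\<^sub>R (blinfun_apply A ^^ i) u)"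
    by (rule poly_op_apply_extend) (simp add: degree_pCons_le)
  also have "\<dots> = a *\<^sub>R u + (\<Sum>i\<le>degree p. coeff p i *\<^sub>R (blinfun_apply A ^^ Suc i) u)"
    by (subst sum.atMost_Suc_shift) simp
  finally show ?thesis
    by (simp add: poly_op_apply blinfun.sum_right blinfun.scaleR_right)
qed

lemma poly_op_add: "poly_op (p + q) A = poly_op p A + poly_op q A"
proof (rule blinfun_eqI)
  fix u
  let ?n = "max (degree p) (degree q)"
  show "blinfun_apply (poly_op (p + q) A) u = blinfun_apply (poly_op p A + poly_op q A) u"
    using poly_op_apply_extend[of "p + q" ?n A u] poly_op_apply_extend[of p ?n A u]
      poly_op_apply_extend[of q ?n A u]
    by (simp add: degree_add_le_max blinfun.add_left sum.distrib scaleR_add_left)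
qed

lemma poly_op_smult: "poly_op (smult c p) A = c *\<^sub>R poly_op p A"
proof (rule blinfun_eqI)
  fix u
  show "blinfun_apply (poly_op (smult c p) A) u = blinfun_apply (c *\<^sub>R poly_op p A) u"
    using poly_op_apply_extend[of "smult c p" "degree p" A u]
    by (simp add: poly_op_apply[of p] degree_smult_le blinfun.scaleR_left scaleR_sum_right)
qed

lemma poly_op_diff: "poly_op (p - q) A = poly_op p A - poly_op q A"
  using poly_op_add[of p "smult (-1) q" A] poly_op_smult[of "-1" q A] by simp

lemma poly_op_mult:
  "blinfun_apply (poly_op (p * q) A) u = blinfun_apply (poly_op p A) (blinfun_apply (poly_op q A) u)"
  by (induction p) (simp_all add: poly_op_add poly_op_smult blinfun.add_left blinfun.scaleR_left)



lemma poly_op_1 [simp]: "poly_op 1 A = id_blinfun"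
  by (rule blinfun_eqI) (simp add: one_pCons)

lemma poly_op_invariant:
  assumes "\<And>u. u \<in> V \<Longrightarrow> blinfun_apply A u \<in> V" "subspace V" "u \<in> V"
  shows "blinfun_apply (poly_op p A) u \<in> V"
  by (induction p) (simp_all add: assms subspace_0 subspace_add subspace_scale)

lemma poly_op_commute:
  "blinfun_apply (poly_op p A) (blinfun_apply A u) = blinfun_apply A (blinfun_apply (poly_op p A) u)"
  by (induction p) (simp_all add: blinfun.add_right blinfun.scaleR_right)

lemma poly_op_symmetric:
  assumes "\<And>u v. inner (blinfun_apply A u) v = inner u (blinfun_apply A v)"
  shows "inner (blinfun_apply (poly_op p A) u) v = inner u (blinfun_apply (poly_op p A) v)"
proof (induction p arbitrary: v)
  case (pCons a p)
  then show ?case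
    by (simp add: inner_add_left inner_add_right assms poly_op_commute)
qed simp

subsection \<open>The sequence space\<close>

lemma subspace_ell2_on: "subspace (ell2_on S)"
  by (simp add: subspace_def ell2_on_def)

lemma ell2_on_UNIV [simp]: "ell2_on UNIV = UNIV"
  by (simp add: ell2_on_def)

lemma tendsto_coord:
  assumes "(X \<longlongrightarrow> u) F"
  shows "((\<lambda>k. coord (X k) n) \<longlongrightarrow> coord u n) F"
proof (rule Lim_transform2[OF tendsto_const])
  have "((\<lambda>k. norm (X k - u)) \<longlongrightarrow> 0) F"
    using assms by (simp add: LIM_zero tendsto_norm_zero)
  then show "((\<lambda>k. coord u n - coord (X k) n) \<longlongrightarrow> 0) F"
    by (rule Lim_null_comparison[rotated])
      (auto intro!: always_eventually simp: coord_simps(3)[symmetric] norm_minus_commute[of _ u] cmod_coord_le_norm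
        simp del: coord_simps)
qed

lemma closed_ell2_on: "closed (ell2_on S)"
  unfolding closed_sequential_limits
proof (intro allI impI, elim conjE)
  fix X u assume X: "\<forall>k. X k \<in> ell2_on S" "X \<longlonglongrightarrow> u"
  have "coord u n = 0" if "n \<notin> S" for n
    using tendsto_coord[OF X(2), of n] X(1) that by (simp add: ell2_on_def LIMSEQ_const_iff)
  then show "u \<in> ell2_on S" by (simp add: ell2_on_def)
qed

lemma cscale_of_real: "cscale (complex_of_real x) u = x *\<^sub>R u"
  by (rule ell2_eqI) simp

lemma coord_delta: "coord (delta k) n = (if n = k then 1 else 0)"
  by (simp add: delta.rep_eq)

text \<open>The inner product on \<open>ell2\<close> is the real part of the Hermitian one, hence
  the \<open>Re\<close>.\<close>

lemma inner_delta: "inner (delta k) u = Re (coord u k)"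
proof -
  have "inner (delta k) u = (\<Sum>\<^sub>\<infinity>n\<in>{k}. inner (coord (delta k) n) (coord u n))"
    unfolding inner_ell2.rep_eq by (rule infsum_cong_neutral) (auto simp: coord_delta)
  then show ?thesis by (simp add: coord_delta)
qed

lemma norm_delta [simp]: "norm (delta k) = 1"
  by (simp add: norm_eq_sqrt_inner inner_delta coord_delta)

lemma proj_ell2_on: "blinfun_apply (proj S) u \<in> ell2_on S"
  by (simp add: ell2_on_def coord_proj)

lemma proj_eq: "u \<in> ell2_on S \<Longrightarrow> blinfun_apply (proj S) u = u"
  by (rule ell2_eqI) (auto simp: ell2_on_def coord_proj)

lemma delta_in_ell2_on: "k \<in> S \<Longrightarrow> delta k \<in> ell2_on S"
  by (auto simp: ell2_on_def coord_delta)

lemma norm_proj_apply_le: "norm (blinfun_apply (proj S) u) \<le> norm u"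
  unfolding norm_ell2 by (intro real_sqrt_le_mono infsum_mono coord_summable) (simp add: coord_proj)

lemma norm_proj_le: "norm (proj S) \<le> 1"
  by (rule norm_blinfun_bound) (simp_all add: norm_proj_apply_le)

lemma proj_symmetric: "inner (blinfun_apply (proj S) u) v = inner u (blinfun_apply (proj S) v)"
  unfolding inner_ell2.rep_eq by (intro infsum_cong) (simp add: coord_proj)

text \<open>A real form of the space. Operators with real matrix entries preserve it, which makes
  their diagonal entries real and turns complex traces into sums of real inner products.\<close>

definition real_ell2 :: "ell2 set" where
  "real_ell2 = {u. \<forall>n. coord u n \<in> \<real>}"

lemma subspace_real_ell2: "subspace real_ell2"
  by (simp add: subspace_def real_ell2_def)

lemma proj_real: "u \<in> real_ell2 \<Longrightarrow> blinfun_apply (proj S) u \<in> real_ell2"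
  by (simp add: real_ell2_def coord_proj)

lemma closed_real_ell2: "closed real_ell2"
  unfolding closed_sequential_limits
proof (intro allI impI, elim conjE)
  fix X u assume X: "\<forall>k. X k \<in> real_ell2" "X \<longlonglongrightarrow> u"
  have "coord u n \<in> \<real>" for n
    by (rule closed_sequentially[OF closed_complex_Reals _ tendsto_coord[OF X(2)]])
      (use X(1) in \<open>simp add: real_ell2_def\<close>)
  then show "u \<in> real_ell2" by (simp add: real_ell2_def)
qed

subsection \<open>Spectrum of a symmetric operator\<close>

text \<open>A non-real root \<open>z\<close> yields the factor \<open>(x - Re z)\<^sup>2 + (Im z)\<^sup>2\<close>; the remainder of the
  division by it is a real linear polynomial vanishing at \<open>z\<close>.\<close>
lemma real_poly_factor:
  fixes r :: "real poly"
  assumes "degree r \<noteq> 0"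
  obtains a q where "r = [:- a, 1:] * q" | a b q where "b \<noteq> 0" "r = ([:- a, 1:]\<^sup>2 + [:b\<^sup>2:]) * q"
proof -
  \<comment> \<open>Evaluation of a real polynomial at a complex point; the next facts show that it
    is a ring homomorphism in the polynomial.\<close>
  define c where "c p = poly (map_poly complex_of_real p)" for p
  have c_pCons: "c (pCons a p) z = complex_of_real a + z * c p z" for a p z
    by (simp add: c_def map_poly_pCons)
  have c_0: "c 0 z = 0" for z by (simp add: c_def)
  have c_add: "c (p + q) z = c p z + c q z" for p q z
  proof -
    have "map_poly complex_of_real (p + q) = map_poly complex_of_real p + map_poly complex_of_real q"
      by (rule poly_eqI) (simp add: coeff_map_poly)
    then show ?thesis by (simp add: c_def)
  qed
  have c_smult: "c (smult a p) z = complex_of_real a * c p z" for a p z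
    unfolding c_def by (subst map_poly_smult) simp_all
  have c_mult: "c (p * q) z = c p z * c q z" for p q z
    by (induction p) (simp_all add: c_0 c_pCons c_add c_smult algebra_simps)
  have "degree (map_poly complex_of_real r) = degree r"
    by (rule degree_map_poly) simp
  then have "\<not> constant (poly (map_poly complex_of_real r))"
    using assms constant_degree by metis
  then obtain z where z: "c r z = 0"
    using fundamental_theorem_of_algebra unfolding c_def by blast
  show thesis
  proof (cases "Im z = 0")
    case True
    then have "z = complex_of_real (Re z)" by (simp add: complex_eq_iff)
    moreover have "c p (complex_of_real x) = complex_of_real (poly p x)" for p x
      by (induction p) (simp_all add: c_0 c_pCons)
    ultimately have "poly r (Re z) = 0" using z by (metis of_real_eq_0_iff)
    then show thesis using that(1) by (metis poly_eq_0_iff_dvd dvdE)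
  next
    case False
    define d where "d = [:- Re z, 1:]\<^sup>2 + [:(Im z)\<^sup>2:]"
    have d: "d = [:(Re z)\<^sup>2 + (Im z)\<^sup>2, - 2 * Re z, 1:]"
      by (simp add: d_def power2_eq_square)
    have "c d z = 0"
      unfolding d by (simp add: c_pCons c_0 complex_eq_iff power2_eq_square algebra_simps)
    then have m: "c (r mod d) z = 0"
      using z c_mult[of "r div d" d z] c_add[of "r div d * d" "r mod d" z] by simp
    have "r mod d = 0 \<or> degree (r mod d) < degree d"
      by (rule degree_mod_less) (simp add: d)
    then have "degree (r mod d) < 2" by (auto simp: d)
    then have "r mod d = [:coeff (r mod d) 0, coeff (r mod d) 1:]"
      by (intro poly_eqI) (auto simp: coeff_pCons coeff_eq_0 split: nat.split)
    then obtain s t where st: "r mod d = [:s, t:]" by blast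
    \<comment> \<open>The imaginary part of \<open>s + z * t\<close> is \<open>t * Im z\<close>,
      which forces \<open>t = 0\<close> and then \<open>s = 0\<close>.\<close>
    from m have "t = 0" "s = 0"
      using False unfolding st by (auto simp: c_pCons c_0 complex_eq_iff)
    then have "r = d * (r div d)" using div_mult_mod_eq[of r d] st by (simp add: mult.commute)
    then show thesis using that(2) False unfolding d_def by blast
  qed
qed

text \<open>A one-sided, quantitative form of invertibility: it survives composition, and for a
  symmetric operator it already yields the norm estimate below.\<close>

definition bounded_below_on :: "'a::real_normed_vector set \<Rightarrow> ('a \<Rightarrow> 'a) \<Rightarrow> bool" where
  "bounded_below_on V B \<longleftrightarrow> (\<exists>c>0. \<forall>u\<in>V. c * norm u \<le> norm (B u))"

lemma bounded_below_on_comp: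
  assumes "bounded_below_on V B" "bounded_below_on V C" "\<And>u. u \<in> V \<Longrightarrow> C u \<in> V"
  shows "bounded_below_on V (\<lambda>u. B (C u))"
proof -
  obtain b c where b: "0 < b" "\<And>u. u \<in> V \<Longrightarrow> b * norm u \<le> norm (B u)"
    and c: "0 < c" "\<And>u. u \<in> V \<Longrightarrow> c * norm u \<le> norm (C u)"
    using assms(1,2) unfolding bounded_below_on_def by blast
  have "b * c * norm u \<le> norm (B (C u))" if "u \<in> V" for u
    using order_trans[OF mult_left_mono[OF c(2)[OF that], of b] b(2)[OF assms(3)[OF that]]] b(1)
    by (simp add: mult.assoc)
  then show ?thesis unfolding bounded_below_on_def using b(1) c(1) by (meson mult_pos_pos)
qed

lemma resolvent_bounded_below:
  assumes "complex_of_real x \<notin> spectrum_on S A"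
  shows "bounded_below_on (ell2_on S) (\<lambda>u. blinfun_apply A u - x *\<^sub>R u)"
proof -
  obtain R :: "ell2 \<Rightarrow>\<^sub>L ell2" where
    R: "\<And>u. u \<in> ell2_on S \<Longrightarrow> blinfun_apply R (blinfun_apply A u - x *\<^sub>R u) = u"
    using assms unfolding spectrum_on_def by (auto simp: cscale_of_real)
  \<comment> \<open>Adding 1 keeps the constant meaningful and positive even if \<open>R\<close> is
    zero.\<close>
  have "inverse (norm R + 1) * norm u \<le> norm (blinfun_apply A u - x *\<^sub>R u)" if "u \<in> ell2_on S" for u
  proof -
    let ?w = "blinfun_apply A u - x *\<^sub>R u"
    have "norm u \<le> norm R * norm ?w" using norm_blinfun[of R ?w] R[OF that] by simp
    also have "\<dots> \<le> (norm R + 1) * norm ?w" by (simp add: mult_right_mono)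
    finally have "norm u / (norm R + 1) \<le> norm ?w"
      by (simp add: pos_divide_le_eq add_nonneg_pos mult.commute)
    then show ?thesis by (simp add: divide_inverse_commute)
  qed
  then show ?thesis unfolding bounded_below_on_def
    by (intro exI[of _ "inverse (norm R + 1)"]) (simp add: add_nonneg_pos)
qed

section \<open>Norms of polynomials in a symmetric operator\<close>

locale symmetric_on =
  fixes S :: "int set" and A :: "ell2 \<Rightarrow>\<^sub>L ell2"
  assumes symmetric: "inner (blinfun_apply A u) v = inner u (blinfun_apply A v)"
    and invariant: "u \<in> ell2_on S \<Longrightarrow> blinfun_apply A u \<in> ell2_on S"
begin

lemma poly_op_ell2_on: "u \<in> ell2_on S \<Longrightarrow> blinfun_apply (poly_op p A) u \<in> ell2_on S"
  using poly_op_invariant[OF invariant subspace_ell2_on] .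

lemma inner_poly_op:
  "inner (blinfun_apply (poly_op p A) u) v = inner u (blinfun_apply (poly_op p A) v)"
  by (rule poly_op_symmetric) (rule symmetric)

text \<open>With \<open>B = A - a\<close>, symmetry turns the quadratic form of the operator at
  \<open>u\<close> into the squared norm of \<open>B u\<close> plus \<open>b\<^sup>2\<close> times
  that of \<open>u\<close>; Cauchy-Schwarz then gives the lower bound. Non-real roots thus never
  obstruct invertibility.\<close>

lemma quadratic_bounded_below:
  assumes "b \<noteq> 0"
  shows "bounded_below_on V (blinfun_apply (poly_op ([:- a, 1:]\<^sup>2 + [:b\<^sup>2:]) A))"
  unfolding bounded_below_on_def
proof (intro exI[of _ "b\<^sup>2"] conjI ballI)
  show "0 < b\<^sup>2" using assms by simp
  fix u
  let ?B = "poly_op [:- a, 1:] A" and ?C = "poly_op ([:- a, 1:]\<^sup>2 + [:b\<^sup>2:]) A"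
  have "blinfun_apply ?C u = blinfun_apply ?B (blinfun_apply ?B u) + b\<^sup>2 *\<^sub>R u"
    by (simp only: power2_eq_square poly_op_add poly_op_mult blinfun.add_left) simp
  then have "inner u (blinfun_apply ?C u) = (norm (blinfun_apply ?B u))\<^sup>2 + b\<^sup>2 * (norm u)\<^sup>2"
    by (simp only: inner_add_right inner_poly_op[of _ u, symmetric] power2_norm_eq_inner inner_scaleR_right)
  then have "b\<^sup>2 * (norm u)\<^sup>2 \<le> norm u * norm (blinfun_apply ?C u)"
    using norm_cauchy_schwarz[of u "blinfun_apply ?C u"] by (smt (verit) zero_le_power2)
  then show "b\<^sup>2 * norm u \<le> norm (blinfun_apply ?C u)"
    by (cases "norm u = 0") (auto simp: power2_eq_square[of "norm u"] mult.left_commute)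
qed

text \<open>Induction on the degree: each real linear factor is bounded below because its root lies
  outside the spectrum, each irreducible quadratic factor by symmetry, and lower bounds multiply
  under composition.\<close>

lemma poly_op_bounded_below:
  assumes "r \<noteq> 0" "\<And>x. poly r x = 0 \<Longrightarrow> complex_of_real x \<notin> spectrum_on S A"
  shows "bounded_below_on (ell2_on S) (blinfun_apply (poly_op r A))"
  using assms
proof (induction "degree r" arbitrary: r rule: less_induct)
  case less
  show ?case
  proof (cases "degree r = 0")
    case True
    then obtain a where r: "r = [:a:]" using degree_eq_zeroE by blast
    with less.prems show ?thesis
      unfolding bounded_below_on_def by (intro exI[of _ "\<bar>a\<bar>"]) simp
  next
    case False
    have step: ?thesis
      if "r = d * q" "degree d > 0" "bounded_below_on (ell2_on S) (blinfun_apply (poly_op d A))" for d q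
    proof -
      have ne: "d \<noteq> 0" "q \<noteq> 0" using less.prems(1) that(1) by auto
      then have "degree q < degree r" using that by (simp add: degree_mult_eq)
      then have "bounded_below_on (ell2_on S) (blinfun_apply (poly_op q A))"
        using less ne that(1) by simp
      from bounded_below_on_comp[OF that(3) this poly_op_ell2_on] show ?thesis
        unfolding that(1) poly_op_mult[symmetric] .
    qed
    from False show ?thesis
    proof (cases r rule: real_poly_factor)
      case (1 a q)
      show ?thesis
      proof (rule step[OF 1])
        have "blinfun_apply (poly_op [:- a, 1:] A) = (\<lambda>u. blinfun_apply A u - a *\<^sub>R u)"
          by (rule ext) simp
        moreover have "complex_of_real a \<notin> spectrum_on S A"
          by (rule less.prems(2)) (simp add: 1)
        ultimately show "bounded_below_on (ell2_on S) (blinfun_apply (poly_op [:- a, 1:] A))"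
          using resolvent_bounded_below[of a S A] by simp
      qed simp
    next
      case (2 a b q)
      show ?thesis
        by (rule step[OF 2(2) _ quadratic_bounded_below[OF 2(1)]]) (simp add: power2_eq_square)
    qed
  qed
qed

text \<open>Unit vectors on which a symmetric operator nearly attains its norm are nearly
  annihilated by its square minus the squared norm. A lower bound for the latter therefore pushes
  the norm of \<open>B\<close> strictly below itself, unless the space is zero.\<close>

lemma norm_poly_op_bounded_below_trivial:
  fixes p
  defines "B \<equiv> poly_op p A o\<^sub>L proj S"
  assumes "bounded_below_on (ell2_on S) (blinfun_apply (poly_op (p\<^sup>2 - [:(norm B)\<^sup>2:]) A))"
  shows "ell2_on S = {0}"
proof (rule ccontr)
  assume ne: "ell2_on S \<noteq> {0}"
  let ?b = "norm B"
  from assms obtain c where c: "0 < c"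
    and bd: "\<And>u. u \<in> ell2_on S \<Longrightarrow> c * norm u \<le> norm (blinfun_apply (poly_op (p\<^sup>2 - [:?b\<^sup>2:]) A) u)"
    unfolding bounded_below_on_def by blast
  have Bu: "norm (blinfun_apply (poly_op p A) u) \<le> ?b * norm u" if "u \<in> ell2_on S" for u
    using norm_blinfun[of B u] by (simp add: B_def proj_eq that)
  \<comment> \<open>Expand the squared norm of \<open>?w - ?b\<^sup>2 *\<^sub>R u\<close>. Symmetry
    makes \<open>inner ?w u\<close> the squared norm of \<open>?v\<close>, and \<open>?w\<close> is
    at most \<open>?b\<close> times as long as \<open>?v\<close>.\<close>
  have key: "(c * norm u)\<^sup>2 \<le> ?b\<^sup>2 * (?b\<^sup>2 * (norm u)\<^sup>2 - (norm (blinfun_apply (poly_op p A) u))\<^sup>2)"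
    if u: "u \<in> ell2_on S" for u
  proof -
    let ?v = "blinfun_apply (poly_op p A) u"
    let ?w = "blinfun_apply (poly_op p A) ?v"
    have sq: "(norm (w - k *\<^sub>R u))\<^sup>2 = (norm w)\<^sup>2 - 2 * k * inner w u + k * k * (norm u)\<^sup>2" for k and w :: ell2
      unfolding power2_norm_eq_inner
      by (simp add: inner_diff_left inner_diff_right inner_commute[of u w] algebra_simps)
    have "blinfun_apply (poly_op (p\<^sup>2 - [:?b\<^sup>2:]) A) u = ?w - ?b\<^sup>2 *\<^sub>R u"
      by (simp add: poly_op_diff power2_eq_square[of p] poly_op_mult blinfun.diff_left)
    then have "(c * norm u)\<^sup>2 \<le> (norm (?w - ?b\<^sup>2 *\<^sub>R u))\<^sup>2"
      using bd[OF u] c by (intro power_mono) simp_all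
    also have "\<dots> = (norm ?w)\<^sup>2 - 2 * ?b\<^sup>2 * inner ?w u + ?b\<^sup>2 * ?b\<^sup>2 * (norm u)\<^sup>2"
      by (rule sq)
    also have "inner ?w u = (norm ?v)\<^sup>2"
      by (simp add: power2_norm_eq_inner inner_poly_op[of _ ?v])
    also have "(norm ?w)\<^sup>2 \<le> (?b * norm ?v)\<^sup>2"
      by (intro power_mono Bu poly_op_ell2_on u) simp
    finally show ?thesis by (simp add: power_mult_distrib algebra_simps)
  qed
  obtain u where u: "u \<in> ell2_on S" "u \<noteq> 0" using ne subspace_0[OF subspace_ell2_on] by blast
  have pos: "0 < (c * norm u)\<^sup>2" using c u by simp
  then have b: "0 < ?b" using key[OF u(1)] by (cases "?b = 0") auto
  \<comment> \<open>Dividing \<open>key\<close> by \<open>?b\<^sup>2\<close> bounds the operator by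
    the root of \<open>?b\<^sup>2 - c\<^sup>2 / ?b\<^sup>2\<close>; the maximum with 0 guarantees
    that the root is nonnegative.\<close>
  define m where "m = sqrt (max 0 (?b\<^sup>2 - c\<^sup>2 / ?b\<^sup>2))"
  have "norm (blinfun_apply (poly_op p A) v) \<le> m * norm v" if v: "v \<in> ell2_on S" for v
  proof -
    have "c\<^sup>2 / ?b\<^sup>2 * (norm v)\<^sup>2 \<le> ?b\<^sup>2 * (norm v)\<^sup>2 - (norm (blinfun_apply (poly_op p A) v))\<^sup>2"
      using key[OF v] b by (simp add: pos_divide_le_eq power_mult_distrib mult.commute)
    then have "(norm (blinfun_apply (poly_op p A) v))\<^sup>2 \<le> (?b\<^sup>2 - c\<^sup>2 / ?b\<^sup>2) * (norm v)\<^sup>2"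
      by (simp add: algebra_simps)
    also have "\<dots> \<le> max 0 (?b\<^sup>2 - c\<^sup>2 / ?b\<^sup>2) * (norm v)\<^sup>2"
      by (intro mult_right_mono) simp_all
    finally have "(norm (blinfun_apply (poly_op p A) v))\<^sup>2 \<le> (m * norm v)\<^sup>2"
      by (simp add: m_def power_mult_distrib)
    then show ?thesis by (rule power2_le_imp_le) (simp add: m_def)
  qed
  then have "norm (blinfun_apply B v) \<le> m * norm v" for v
    using mult_left_mono[OF norm_proj_apply_le[of S v], of m]
    by (auto simp: B_def m_def intro: order_trans proj_ell2_on)
  then have "?b \<le> m" by (intro norm_blinfun_bound) (simp_all add: m_def)
  moreover have "m < ?b"
    unfolding m_def using b c by (intro real_less_lsqrt) (simp_all add: max_def)
  ultimately show False by simp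
qed

text \<open>If the norm exceeded \<open>c\<close>, its square would not be a value of
  \<open>p\<^sup>2\<close> on the real points of the spectrum. The preceding lemma then makes the
  space zero, and the norm would be 0.\<close>

lemma norm_poly_op_le:
  assumes "\<And>x. complex_of_real x \<in> spectrum_on S A \<Longrightarrow> \<bar>poly p x\<bar> \<le> c" "0 \<le> c"
  shows "norm (poly_op p A o\<^sub>L proj S) \<le> c"
proof (rule ccontr)
  let ?b = "\<lambda>p. norm (poly_op p A o\<^sub>L proj S)"
  assume "\<not> ?b p \<le> c"
  then have b: "c < ?b p" by simp
  have trivial: "ell2_on S = {0}"
    if "q\<^sup>2 \<noteq> [:(?b q)\<^sup>2:]" "\<And>x. (poly q x)\<^sup>2 = (?b q)\<^sup>2 \<Longrightarrow> complex_of_real x \<notin> spectrum_on S A" for q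
    by (rule norm_poly_op_bounded_below_trivial[OF poly_op_bounded_below]) (use that in \<open>auto\<close>)
  have no_root: "complex_of_real x \<notin> spectrum_on S A" if "(poly p x)\<^sup>2 = (?b p)\<^sup>2" for x
    using assms(1)[of x] b that by (auto simp: power2_eq_iff abs_if split: if_splits)
  have "ell2_on S = {0}"
  proof (cases "p\<^sup>2 = [:(?b p)\<^sup>2:]")
    \<comment> \<open>Here \<open>p\<^sup>2 - [:(?b p)\<^sup>2:]\<close> is the zero polynomial and
      cannot be factored. But now every real number satisfies the premise of \<open>no_root\<close>,
      so the spectrum has no real point, and the argument runs with the polynomial
      \<open>[:0, 1:]\<close> instead.\<close>
    case True
    then have "(poly p x)\<^sup>2 = (?b p)\<^sup>2" for x by (metis poly_power poly_const_conv)
    moreover have "[:0, 1:]\<^sup>2 \<noteq> [:(?b [:0, 1:])\<^sup>2:]" by (simp add: power2_eq_square)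
    ultimately show ?thesis using trivial no_root by blast
  qed (use trivial no_root in blast)
  then have "blinfun_apply (proj S) u = 0" for u using proj_ell2_on[of S u] by simp
  then have "poly_op p A o\<^sub>L proj S = 0" by (intro blinfun_eqI) simp
  then show False using b assms(2) by simp
qed

text \<open>Neumann series: with \<open>C = A / x\<close> of norm below 1, the sum \<open>N\<close>
  of the powers of \<open>C\<close> inverts the identity minus \<open>C\<close>, and
  \<open>- N / x\<close> is a resolvent at \<open>x\<close>. It maps \<open>ell2_on S\<close> into
  itself because that subspace is closed.\<close>

lemma spectrum_bounded:
  assumes "complex_of_real x \<in> spectrum_on S A"
  shows "\<bar>x\<bar> \<le> norm A"
proof (rule ccontr)
  assume "\<not> \<bar>x\<bar> \<le> norm A"
  then have x: "norm A < \<bar>x\<bar>" by simp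
  then have x0: "x \<noteq> 0" by auto
  define C where "C = (1 / x) *\<^sub>R A"
  have C1: "norm C < 1" using x x0 by (simp add: C_def pos_divide_less_eq)
  define P where "P i = (((o\<^sub>L) C) ^^ i) id_blinfun" for i
  have P_apply: "blinfun_apply (P i) u = (blinfun_apply C ^^ i) u" for i u
    by (simp add: P_def funpow_compose_blinfun_apply)
  have P_norm: "norm (P i) \<le> norm C ^ i" for i
  proof (induction i)
    case 0 show ?case by (simp add: P_def norm_blinfun_id_le)
  next
    case (Suc i)
    have "norm (P (Suc i)) \<le> norm C * norm (P i)" by (simp add: P_def norm_blinfun_compose)
    also have "\<dots> \<le> norm C * norm C ^ i" by (intro mult_left_mono Suc) simp
    finally show ?case by simp
  qed
  have "summable P"
    by (rule summable_comparison_test'[OF summable_geometric]) (use C1 P_norm in auto)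
  then have "(\<lambda>n. blinfun_apply (\<Sum>i<n. P i) u) \<longlonglongrightarrow> blinfun_apply (suminf P) u" for u
    by (intro blinfun.tendsto tendsto_const summable_LIMSEQ)
  then have sums: "(\<lambda>i. (blinfun_apply C ^^ i) u) sums blinfun_apply (suminf P) u" for u
    by (simp add: sums_def blinfun.sum_left P_apply)
  define N where "N = suminf P"
  \<comment> \<open>Applying \<open>C\<close> shifts the series by one index, which removes exactly
    the initial term \<open>u\<close>.\<close>
  have N1: "blinfun_apply N u - blinfun_apply C (blinfun_apply N u) = u" for u
  proof -
    have "(\<lambda>i. blinfun_apply C ((blinfun_apply C ^^ i) u)) sums blinfun_apply C (blinfun_apply N u)"
      unfolding N_def by (intro bounded_linear.sums[OF _ sums] blinfun.bounded_linear_right)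
    moreover have "(\<lambda>i. blinfun_apply C ((blinfun_apply C ^^ i) u)) sums (blinfun_apply N u - u)"
      using sums[of u] sums_Suc_iff[of "\<lambda>i. (blinfun_apply C ^^ i) u"] by (simp add: N_def)
    ultimately show ?thesis using sums_unique2 by fastforce
  qed
  have N2: "blinfun_apply N (u - blinfun_apply C u) = u" for u
  proof -
    have "(\<lambda>i. (blinfun_apply C ^^ i) (blinfun_apply C u)) sums blinfun_apply N (blinfun_apply C u)"
      unfolding N_def by (rule sums)
    moreover have "(\<lambda>i. (blinfun_apply C ^^ i) (blinfun_apply C u)) sums (blinfun_apply N u - u)"
      using sums[of u] sums_Suc_iff[of "\<lambda>i. (blinfun_apply C ^^ i) u"]
      by (simp add: N_def funpow_swap1)
    ultimately have "blinfun_apply N (blinfun_apply C u) = blinfun_apply N u - u"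
      using sums_unique2 by blast
    then show ?thesis by (simp add: blinfun.diff_right)
  qed
  have C_on: "blinfun_apply C u \<in> ell2_on S" if "u \<in> ell2_on S" for u
    using invariant[OF that] subspace_scale[OF subspace_ell2_on] by (simp add: C_def blinfun.scaleR_left)
  have N_on: "blinfun_apply N u \<in> ell2_on S" if u: "u \<in> ell2_on S" for u
  proof (rule closed_sequentially[OF closed_ell2_on])
    show "(\<lambda>n. \<Sum>i<n. (blinfun_apply C ^^ i) u) \<longlonglongrightarrow> blinfun_apply N u"
      using sums[of u] by (simp add: sums_def N_def)
    have "(blinfun_apply C ^^ i) u \<in> ell2_on S" for i by (induction i) (simp_all add: u C_on)
    then show "\<And>n. (\<Sum>i<n. (blinfun_apply C ^^ i) u) \<in> ell2_on S"
      by (intro subspace_sum[OF subspace_ell2_on])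
  qed
  define R where "R = (- (1 / x)) *\<^sub>R N"
  have A: "blinfun_apply A u = x *\<^sub>R blinfun_apply C u" for u
    using x0 by (simp add: C_def blinfun.scaleR_left)
  have "blinfun_apply R u \<in> ell2_on S \<and>
      blinfun_apply R (blinfun_apply A u - x *\<^sub>R u) = u \<and>
      blinfun_apply A (blinfun_apply R u) - x *\<^sub>R blinfun_apply R u = u" if "u \<in> ell2_on S" for u
  proof (intro conjI)
    show "blinfun_apply R u \<in> ell2_on S"
      using N_on[OF that] subspace_scale[OF subspace_ell2_on, of _ S "- (1 / x)"]
      by (simp add: R_def blinfun.scaleR_left blinfun.minus_left)
    have "blinfun_apply R (blinfun_apply A u - x *\<^sub>R u) = blinfun_apply N (u - blinfun_apply C u)"
      using x0 by (simp add: R_def A blinfun.bilinear_simps scaleR_diff_right)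
    then show "blinfun_apply R (blinfun_apply A u - x *\<^sub>R u) = u" by (simp add: N2)
    have "blinfun_apply A (blinfun_apply R u) - x *\<^sub>R blinfun_apply R u
        = blinfun_apply N u - blinfun_apply C (blinfun_apply N u)"
      using x0 by (simp add: R_def A blinfun.bilinear_simps)
    then show "blinfun_apply A (blinfun_apply R u) - x *\<^sub>R blinfun_apply R u = u" by (simp add: N1)
  qed
  then have "complex_of_real x \<notin> spectrum_on S A"
    unfolding spectrum_on_def by (auto simp: cscale_of_real)
  with assms show False by simp
qed

end

subsection \<open>Continuous functional calculus\<close>

lemma continuous_bounded_on_interval:
  fixes g :: "real \<Rightarrow> real"
  assumes "continuous_on UNIV g"
  obtains c where "\<And>x. x \<in> {a..b} \<Longrightarrow> \<bar>g x\<bar> \<le> c"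
proof -
  have "bounded (g ` {a..b})"
    by (intro compact_imp_bounded compact_continuous_image continuous_on_subset[OF assms]) simp_all
  then have "\<exists>c. \<forall>x\<in>{a..b}. \<bar>g x\<bar> \<le> c" unfolding bounded_iff by simp
  then show thesis using that by blast
qed

lemma real_poly_uniform_approx:
  fixes g :: "real \<Rightarrow> real"
  assumes "continuous_on {a..b} g" "0 < e"
  obtains p :: "real poly" where "\<And>x. x \<in> {a..b} \<Longrightarrow> \<bar>g x - poly p x\<bar> < e"
proof -
  obtain h where h: "real_polynomial_function h" "\<And>x. x \<in> {a..b} \<Longrightarrow> \<bar>g x - h x\<bar> < e"
    using Stone_Weierstrass_real_polynomial_function[OF compact_Icc assms] by blast
  from h(1) obtain c n where "h = (\<lambda>x. \<Sum>i\<le>n. c i * x ^ i)"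
    unfolding real_polynomial_function_iff_sum by blast
  then have "poly (\<Sum>i\<le>n. monom (c i) i) x = h x" for x
    by (simp add: poly_sum poly_monom)
  then show thesis using h(2) that by metis
qed

text \<open>A bound \<open>K\<close> is a parameter instead of the exact norm, so that one interval
  \<open>{- K..K}\<close> can serve a whole family of operators and all their compressions.\<close>

locale real_symmetric_on = symmetric_on +
  fixes K :: real
  assumes real: "u \<in> real_ell2 \<Longrightarrow> blinfun_apply A u \<in> real_ell2"
    and norm_le: "norm A \<le> K"
begin

lemma K_nonneg: "0 \<le> K"
  using norm_le norm_ge_zero order_trans by blast

lemma spectrum_in_interval: "complex_of_real x \<in> spectrum_on S A \<Longrightarrow> x \<in> {- K..K}"
  using spectrum_bounded[of x] norm_le by auto

abbreviation poly_op_on :: "real poly \<Rightarrow> ell2 \<Rightarrow>\<^sub>L ell2" where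
  "poly_op_on p \<equiv> poly_op p A o\<^sub>L proj S"

abbreviation approximates :: "(nat \<Rightarrow> real poly) \<Rightarrow> (real \<Rightarrow> real) \<Rightarrow> bool" where
  "approximates p g \<equiv> 
     uniform_limit {x. complex_of_real x \<in> spectrum_on S A} (\<lambda>k. poly (p k)) g sequentially"

lemma poly_op_on_diff: "poly_op_on p - poly_op_on q = poly_op_on (p - q)"
  by (rule blinfun_eqI) (simp add: poly_op_diff blinfun.diff_left)

lemma ex_approximates:
  assumes "continuous_on UNIV g"
  obtains p where "approximates p g"
proof -
  have "\<exists>p. \<forall>x\<in>{- K..K}. \<bar>g x - poly p x\<bar> < inverse (real (Suc k))" for k
    using real_poly_uniform_approx[OF continuous_on_subset[OF assms], of "- K" K "inverse (real (Suc k))"]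
    by (metis inverse_positive_iff_positive of_nat_0_less_iff top_greatest zero_less_Suc)
  then obtain p where p: "\<And>k x. x \<in> {- K..K} \<Longrightarrow> \<bar>g x - poly (p k) x\<bar> < inverse (real (Suc k))"
    by metis
  have "approximates p g"
  proof (rule uniform_limitI)
    fix e :: real assume "0 < e"
    then have "\<forall>\<^sub>F k in sequentially. inverse (real (Suc k)) < e"
      using LIMSEQ_inverse_real_of_nat by (rule order_tendstoD(2)[rotated])
    then show "\<forall>\<^sub>F k in sequentially. \<forall>x\<in>{x. complex_of_real x \<in> spectrum_on S A}. dist (poly (p k) x) (g x) < e"
    proof eventually_elim
      case (elim k)
      then show ?case using p[of _ k] spectrum_in_interval
        by (fastforce simp: dist_real_def abs_minus_commute)
    qed
  qed
  then show thesis by (rule that)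
qed

text \<open>Polynomials uniformly close on the spectrum give operators close in norm. Hence every
  approximating sequence is Cauchy and any two share their limit, which makes the definite
  description in \<open>cfc_on\<close> denote.\<close>

lemma cfc_tendsto:
  assumes g: "continuous_on UNIV g" and p: "approximates p g"
  shows "(\<lambda>k. poly_op_on (p k)) \<longlonglongrightarrow> cfc_on S A g"
proof -
  have small: "\<exists>N. \<forall>m\<ge>N. \<forall>n\<ge>N. norm (poly_op_on (q m) - poly_op_on (r n)) < e"
    if q: "approximates q g" and r: "approximates r g" and e: "0 < e" for q r e
  proof -
    from e have e4: "0 < e / 4" by simp
    obtain N1 N2
      where N1: "\<And>n x. n \<ge> N1 \<Longrightarrow> complex_of_real x \<in> spectrum_on S A \<Longrightarrow> dist (poly (q n) x) (g x) < e / 4"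
        and N2: "\<And>n x. n \<ge> N2 \<Longrightarrow> complex_of_real x \<in> spectrum_on S A \<Longrightarrow> dist (poly (r n) x) (g x) < e / 4"
      using q r e4 unfolding uniform_limit_sequentially_iff by (metis mem_Collect_eq)
    have "norm (poly_op_on (q m) - poly_op_on (r n)) \<le> e / 2" if "m \<ge> max N1 N2" "n \<ge> max N1 N2" for m n
      unfolding poly_op_on_diff
    proof (rule norm_poly_op_le)
      fix x assume x: "complex_of_real x \<in> spectrum_on S A"
      show "\<bar>poly (q m - r n) x\<bar> \<le> e / 2"
      proof -
        have "\<bar>poly (q m) x - g x\<bar> < e / 4" "\<bar>poly (r n) x - g x\<bar> < e / 4"
          using N1[OF _ x, of m] N2[OF _ x, of n] that by (simp_all add: dist_real_def)
        then show ?thesis unfolding poly_diff by linarith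
      qed
    qed (use e in simp)
    then show ?thesis using e by (intro exI[of _ "max N1 N2"] allI impI) fastforce
  qed
  obtain q where q: "approximates q g" using ex_approximates[OF g] .
  have "Cauchy (\<lambda>k. poly_op_on (q k))"
    by (rule CauchyI) (rule small[OF q q])
  then obtain B where B: "(\<lambda>k. poly_op_on (q k)) \<longlonglongrightarrow> B"
    using Cauchy_convergent_iff convergent_def by blast
  have lim: "(\<lambda>k. poly_op_on (r k)) \<longlonglongrightarrow> B" if r: "approximates r g" for r
  proof -
    have "(\<lambda>k. poly_op_on (r k) - poly_op_on (q k)) \<longlonglongrightarrow> 0"
      by (rule LIMSEQ_I) (use small[OF r q] in fastforce)
    from tendsto_add[OF this B] show ?thesis by simp
  qed
  have "cfc_on S A g = B"
    unfolding cfc_on_def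
  proof (rule the_equality)
    show "\<forall>p. approximates p g \<longrightarrow> (\<lambda>k. poly_op_on (p k)) \<longlonglongrightarrow> B" using lim by blast
    show "C = B" if "\<forall>p. approximates p g \<longrightarrow> (\<lambda>k. poly_op_on (p k)) \<longlonglongrightarrow> C" for C
      using that q B LIMSEQ_unique by blast
  qed
  with lim p show ?thesis by blast
qed

lemma cfc_poly: "cfc_on S A (poly p) = poly_op_on p"
proof -
  have "(\<lambda>k. poly_op_on p) \<longlonglongrightarrow> cfc_on S A (poly p)"
    by (rule cfc_tendsto) (auto intro!: continuous_intros uniform_limit_const)
  then show ?thesis by (simp add: LIMSEQ_const_iff)
qed

lemma cfc_add:
  assumes "continuous_on UNIV g" "continuous_on UNIV h"
  shows "cfc_on S A (\<lambda>x. g x + h x) = cfc_on S A g + cfc_on S A h"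
proof -
  obtain p q where p: "approximates p g" and q: "approximates q h"
    using ex_approximates assms by metis
  have "approximates (\<lambda>k. p k + q k) (\<lambda>x. g x + h x)"
    using uniform_limit_add[OF p q] by (simp add: poly_add[abs_def])
  then have "(\<lambda>k. poly_op_on (p k + q k)) \<longlonglongrightarrow> cfc_on S A (\<lambda>x. g x + h x)"
    by (intro cfc_tendsto continuous_intros assms)
  moreover have "poly_op_on (p k + q k) = poly_op_on (p k) + poly_op_on (q k)" for k
    by (rule blinfun_eqI) (simp add: poly_op_add blinfun.add_left)
  moreover have "(\<lambda>k. poly_op_on (p k) + poly_op_on (q k)) \<longlonglongrightarrow> cfc_on S A g + cfc_on S A h"
    by (intro tendsto_add cfc_tendsto assms p q)
  ultimately show ?thesis using LIMSEQ_unique by simp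
qed

lemma cfc_scale:
  assumes "continuous_on UNIV g"
  shows "cfc_on S A (\<lambda>x. c * g x) = c *\<^sub>R cfc_on S A g"
proof -
  obtain p where p: "approximates p g" using ex_approximates assms by metis
  have "approximates (\<lambda>k. smult c (p k)) (\<lambda>x. c * g x)"
    using bounded_linear.uniform_limit[OF bounded_linear_mult_right p, of c]
    by (simp add: poly_smult[abs_def])
  then have "(\<lambda>k. poly_op_on (smult c (p k))) \<longlonglongrightarrow> cfc_on S A (\<lambda>x. c * g x)"
    by (intro cfc_tendsto continuous_intros assms)
  moreover have "poly_op_on (smult c (p k)) = c *\<^sub>R poly_op_on (p k)" for k
    by (rule blinfun_eqI) (simp add: poly_op_smult blinfun.scaleR_left)
  moreover have "(\<lambda>k. c *\<^sub>R poly_op_on (p k)) \<longlonglongrightarrow> c *\<^sub>R cfc_on S A g"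
    by (intro tendsto_intros cfc_tendsto assms p)
  ultimately show ?thesis using LIMSEQ_unique by simp
qed

lemma norm_cfc_le:
  assumes g: "continuous_on UNIV g" and c: "\<And>x. x \<in> {- K..K} \<Longrightarrow> \<bar>g x\<bar> \<le> c"
  shows "norm (cfc_on S A g) \<le> c"
proof (rule field_le_epsilon)
  fix e :: real assume e: "0 < e"
  have c0: "0 \<le> c" using c[of 0] K_nonneg by auto
  obtain p where p: "approximates p g" using ex_approximates g by metis
  have "\<forall>\<^sub>F k in sequentially. norm (poly_op_on (p k)) \<le> c + e"
    using uniform_limitD[OF p e]
  proof eventually_elim
    case (elim k)
    show ?case
    proof (rule norm_poly_op_le)
      fix x assume x: "complex_of_real x \<in> spectrum_on S A"
      then have "dist (poly (p k) x) (g x) < e" using elim by blast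
      with c[OF spectrum_in_interval[OF x]] show "\<bar>poly (p k) x\<bar> \<le> c + e"
        by (simp add: dist_real_def)
    qed (use c0 e in simp)
  qed
  then show "norm (cfc_on S A g) \<le> c + e"
    by (rule tendsto_upperbound[OF tendsto_norm[OF cfc_tendsto[OF g p]]]) simp
qed

lemma cfc_real:
  assumes g: "continuous_on UNIV g" and u: "u \<in> real_ell2"
  shows "blinfun_apply (cfc_on S A g) u \<in> real_ell2"
proof -
  obtain p where p: "approximates p g" using ex_approximates g by metis
  have "blinfun_apply (proj S) u \<in> real_ell2" by (rule proj_real[OF u])
  then have "blinfun_apply (poly_op_on (p k)) u \<in> real_ell2" for k
    using poly_op_invariant[OF real subspace_real_ell2] by simp
  moreover have "(\<lambda>k. blinfun_apply (poly_op_on (p k)) u) \<longlonglongrightarrow> blinfun_apply (cfc_on S A g) u"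
    by (intro blinfun.tendsto tendsto_const cfc_tendsto g p)
  ultimately show ?thesis by (rule closed_sequentially[OF closed_real_ell2])
qed

text \<open>The normalized trace as a real number. The window \<open>W\<close> is separate from the
  set \<open>S\<close> carrying the operator: for \<open>dk\<close> the operator lives on all
  integers, for \<open>dk_tilde\<close> on the window itself.\<close>

definition averaged :: "int set \<Rightarrow> (real \<Rightarrow> real) \<Rightarrow> real" where
  "averaged W g = (\<Sum>n\<in>W. inner (delta n) (blinfun_apply (cfc_on S A g) (delta n))) / card W"

text \<open>Since \<open>delta n\<close> has real coordinates and the functional calculus preserves
  \<open>real_ell2\<close>, the diagonal entries are real and taking real parts loses
  nothing.\<close>

lemma trace_cfc:
  assumes "continuous_on UNIV g"
  shows "1 / of_nat (card W) * trace_on W (cfc_on S A g) = complex_of_real (averaged W g)"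
proof -
  have "delta n \<in> real_ell2" for n by (simp add: real_ell2_def coord_delta)
  then have "coord (blinfun_apply (cfc_on S A g) (delta n)) n \<in> \<real>" for n
    using cfc_real[OF assms] by (simp add: real_ell2_def)
  then have "coord (blinfun_apply (cfc_on S A g) (delta n)) n
      = complex_of_real (inner (delta n) (blinfun_apply (cfc_on S A g) (delta n)))" for n
    by (simp add: inner_delta)
  then show ?thesis by (simp add: trace_on_def averaged_def)
qed

lemma averaged_add:
  assumes "continuous_on UNIV g" "continuous_on UNIV h"
  shows "averaged W (\<lambda>x. g x + h x) = averaged W g + averaged W h"
  by (simp add: averaged_def cfc_add[OF assms] blinfun.add_left inner_add_right sum.distrib add_divide_distrib)

lemma averaged_scale:
  assumes "continuous_on UNIV g"
  shows "averaged W (\<lambda>x. c * g x) = c * averaged W g"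
  by (simp add: averaged_def cfc_scale[OF assms] blinfun.scaleR_left sum_distrib_left)

lemma averaged_poly:
  assumes "W \<subseteq> S"
  shows "averaged W (poly p) = (\<Sum>n\<in>W. inner (delta n) (blinfun_apply (poly_op p A) (delta n))) / card W"
proof -
  have "blinfun_apply (proj S) (delta n) = delta n" if "n \<in> W" for n
    using assms that by (intro proj_eq delta_in_ell2_on) auto
  then show ?thesis by (simp add: averaged_def cfc_poly)
qed

lemma averaged_1:
  assumes "W \<subseteq> S" "finite W" "W \<noteq> {}"
  shows "averaged W (\<lambda>_. 1) = 1"
  using averaged_poly[OF assms(1), of 1] assms(2,3) by (simp add: inner_delta coord_delta fun_eq_iff poly_1[abs_def])

lemma averaged_abs_le:
  assumes W: "finite W" "W \<noteq> {}"
    and g: "continuous_on UNIV g" "\<And>x. x \<in> {- K..K} \<Longrightarrow> \<bar>g x\<bar> \<le> c"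
  shows "\<bar>averaged W g\<bar> \<le> c"
proof -
  have "\<bar>inner (delta n) (blinfun_apply (cfc_on S A g) (delta n))\<bar> \<le> c" for n
  proof -
    have "\<bar>inner (delta n) (blinfun_apply (cfc_on S A g) (delta n))\<bar>
        \<le> norm (blinfun_apply (cfc_on S A g) (delta n))"
      using Cauchy_Schwarz_ineq2[of "delta n"] by simp
    also have "\<dots> \<le> norm (cfc_on S A g)" using norm_blinfun[of _ "delta n"] by simp
    also have "\<dots> \<le> c" by (rule norm_cfc_le[OF g])
    finally show ?thesis .
  qed
  then have "\<bar>\<Sum>n\<in>W. inner (delta n) (blinfun_apply (cfc_on S A g) (delta n))\<bar> \<le> card W * c"
    by (rule order_trans[OF sum_abs sum_bounded_above[of W, simplified]])
  then show ?thesis using W by (simp add: averaged_def pos_divide_le_eq mult.commute card_gt_0_iff)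
qed

lemma averaged_diff_le:
  assumes "finite W" "W \<noteq> {}" and g: "continuous_on UNIV g" "continuous_on UNIV h"
    and "\<And>x. x \<in> {- K..K} \<Longrightarrow> \<bar>g x - h x\<bar> \<le> c"
  shows "\<bar>averaged W g - averaged W h\<bar> \<le> c"
proof -
  have "averaged W (\<lambda>x. g x + (- 1) * h x) = averaged W g + (- 1) * averaged W h"
    by (subst averaged_add averaged_scale, (intro continuous_intros g)+)+ simp
  then have "averaged W g - averaged W h = averaged W (\<lambda>x. g x - h x)" by simp
  then show ?thesis using averaged_abs_le[of W "\<lambda>x. g x - h x" c] assms
    by (simp add: continuous_on_diff)
qed

lemma inner_delta_poly_op_le:
  assumes "n \<in> S" "\<And>x. x \<in> {- K..K} \<Longrightarrow> \<bar>poly p x\<bar> \<le> c"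
  shows "\<bar>inner (delta n) (blinfun_apply (poly_op p A) (delta n))\<bar> \<le> c"
  using averaged_abs_le[of "{n}" "poly p" c] averaged_poly[of "{n}" p] assms
  by (simp add: continuous_on_poly)

end

subsection \<open>Representing measures\<close>

text \<open>The measure is the image of the weighted point measure on \<open>I\<close> under
  \<open>x\<close>; nodes are allowed to coincide.\<close>

lemma finitely_supported_distribution:
  fixes w :: "'b \<Rightarrow> real" and x :: "'b \<Rightarrow> real"
  assumes "finite I" "\<And>i. i \<in> I \<Longrightarrow> 0 \<le> w i" "(\<Sum>i\<in>I. w i) = 1" "\<And>i. i \<in> I \<Longrightarrow> x i \<in> {a<..b}"
  obtains \<nu> :: "real measure" where "real_distribution \<nu>" "measure \<nu> {a<..b} = 1"
    "\<And>g :: real \<Rightarrow> real. g \<in> borel_measurable borel \<Longrightarrow> (\<integral>x. g x \<partial>\<nu>) = (\<Sum>i\<in>I. w i * g (x i))"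
proof -
  interpret prob_space "point_measure I w"
    using assms(1-3) by (intro prob_space_point_measure) (simp_all add: sum_ennreal)
  define \<nu> where "\<nu> = distr (point_measure I w) borel x"
  have x [measurable]: "x \<in> borel_measurable (point_measure I w)" by (simp add: point_measure_def)
  show thesis
  proof (rule that[of \<nu>])
    show "real_distribution \<nu>" unfolding \<nu>_def by (rule real_distribution_distr[OF x])
    have "x -` {a<..b} \<inter> space (point_measure I w) = space (point_measure I w)"
      using assms(4) by (auto simp: space_point_measure)
    then show "measure \<nu> {a<..b} = 1"
      unfolding \<nu>_def by (subst measure_distr[OF x]) (simp_all add: prob_space)
    show "(\<integral>x. g x \<partial>\<nu>) = (\<Sum>i\<in>I. w i * g (x i))" if "g \<in> borel_measurable borel" for g :: "real \<Rightarrow> real"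
      unfolding \<nu>_def using that assms(1,2)
      by (subst integral_distr) (simp_all add: lebesgue_integral_point_measure_finite)
  qed
qed

text \<open>The test functions \<open>cos (t * x)\<close> and \<open>sin (t * x)\<close> give the
  real and imaginary parts of the characteristic function, so Levy's uniqueness theorem
  applies.\<close>

lemma real_distribution_eqI:
  assumes \<mu>: "real_distribution \<mu>" and \<nu>: "real_distribution \<nu>"
    and eq: "\<And>g :: real \<Rightarrow> real. continuous_on UNIV g \<Longrightarrow> (\<And>x. \<bar>g x\<bar> \<le> 1) \<Longrightarrow>
      (\<integral>x. g x \<partial>\<mu>) = (\<integral>x. g x \<partial>\<nu>)"
  shows "\<mu> = \<nu>"
proof (rule Levy_uniqueness[OF \<mu> \<nu>], rule ext)
  have char: "char \<kappa> t = Complex (\<integral>x. cos (t * x) \<partial>\<kappa>) (\<integral>x. sin (t * x) \<partial>\<kappa>)"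
    if "real_distribution \<kappa>" for \<kappa> t
  proof -
    interpret real_distribution \<kappa> by fact
    have i: "integrable \<kappa> (\<lambda>x. iexp (t * x))"
      by (rule integrable_const_bound[of _ 1]) auto
    show ?thesis
      unfolding char_def by (rule complex_eqI)
        (use integral_Re[OF i] integral_Im[OF i] in \<open>simp_all add: Re_exp Im_exp\<close>)
  qed
  show "char \<mu> t = char \<nu> t" for t
    unfolding char[OF \<mu>] char[OF \<nu>] by (intro arg_cong2[where f = Complex] eq continuous_intros) simp_all
qed

text \<open>Linearity is asked for on continuous functions, and positivity tests values in
  \<open>{- K..K}\<close> only: this encodes that the represented measure is supported there.
  Positive \<open>K\<close> allows rescaling the interval to the unit interval.\<close>

locale positive_functional =
  fixes L :: "(real \<Rightarrow> real) \<Rightarrow> real" and K :: real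
  assumes K_pos: "0 < K"
    and add: "continuous_on UNIV g \<Longrightarrow> continuous_on UNIV h \<Longrightarrow> L (\<lambda>x. g x + h x) = L g + L h"
    and scale: "continuous_on UNIV g \<Longrightarrow> L (\<lambda>x. c * g x) = c * L g"
    and nonneg: "continuous_on UNIV g \<Longrightarrow> (\<And>x. x \<in> {- K..K} \<Longrightarrow> 0 \<le> g x) \<Longrightarrow> 0 \<le> L g"
    and one: "L (\<lambda>_. 1) = 1"
begin

lemma diff:
  assumes "continuous_on UNIV g" "continuous_on UNIV h"
  shows "L (\<lambda>x. g x - h x) = L g - L h"
  using add[OF assms(1), of "\<lambda>x. (- 1) * h x"] scale[OF assms(2), of "- 1"] assms(2)
  by (simp add: continuous_on_minus)

lemma const: "L (\<lambda>_. c) = c"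
  using scale[of "\<lambda>_. 1" c] one by simp

lemma mono:
  assumes "continuous_on UNIV g" "continuous_on UNIV h" "\<And>x. x \<in> {- K..K} \<Longrightarrow> g x \<le> h x"
  shows "L g \<le> L h"
  using nonneg[of "\<lambda>x. h x - g x"] diff[of h g] assms by (simp add: continuous_on_diff)

lemma cong_interval:
  assumes "continuous_on UNIV g" "continuous_on UNIV h" "\<And>x. x \<in> {- K..K} \<Longrightarrow> g x = h x"
  shows "L g = L h"
  using mono[OF assms(1,2)] mono[OF assms(2,1)] assms(3) by (intro antisym) simp_all

lemma diff_le:
  assumes "continuous_on UNIV g" "continuous_on UNIV h" "\<And>x. x \<in> {- K..K} \<Longrightarrow> \<bar>g x - h x\<bar> \<le> c"
  shows "\<bar>L g - L h\<bar> \<le> c"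
proof -
  have "- c \<le> g x - h x" "g x - h x \<le> c" if "x \<in> {- K..K}" for x
    using assms(3)[OF that] by auto
  then have "L (\<lambda>_. - c) \<le> L (\<lambda>x. g x - h x)" "L (\<lambda>x. g x - h x) \<le> L (\<lambda>_. c)"
    by (intro mono continuous_intros assms(1,2); simp)+
  then show ?thesis by (simp only: const diff[OF assms(1,2)])
qed

lemma sum:
  assumes "finite I" "\<And>i. i \<in> I \<Longrightarrow> continuous_on UNIV (g i)"
  shows "L (\<lambda>x. \<Sum>i\<in>I. c i * g i x) = (\<Sum>i\<in>I. c i * L (g i))"
  using assms
proof (induction I rule: finite_induct)
  case empty
  then show ?case using const[of 0] by simp
next
  case (insert i I)
  then have "L (\<lambda>x. c i * g i x + (\<Sum>i\<in>I. c i * g i x)) = L (\<lambda>x. c i * g i x) + L (\<lambda>x. \<Sum>i\<in>I. c i * g i x)"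
    by (intro add continuous_intros) simp_all
  with insert show ?case by (simp add: scale)
qed

text \<open>Applying the functional to the Bernstein basis gives the weights of discrete approximations
  of the measure; Helly's theorem provides the limit.\<close>
lemma ex_measure_bounded:
  obtains \<kappa> where "real_distribution \<kappa>"
    "\<And>g C. continuous_on UNIV g \<Longrightarrow> (\<And>x. \<bar>g x\<bar> \<le> C) \<Longrightarrow> (\<integral>x. g x \<partial>\<kappa>) = L g"
proof -
  \<comment> \<open>The affine map from the unit interval onto \<open>{- K..K}\<close>, followed by
    its inverse, carries the Bernstein basis over to \<open>{- K..K}\<close>.\<close>
  define \<phi> where "\<phi> t = 2 * K * t - K" for t
  define \<psi> where "\<psi> x = (x + K) / (2 * K)" for x
  have \<phi>\<psi>: "\<phi> (\<psi> x) = x" for x using K_pos by (simp add: \<phi>_def \<psi>_def)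
  have \<psi>: "\<psi> x \<in> {0..1}" if "x \<in> {- K..K}" for x
    using that K_pos by (simp add: \<psi>_def)
  define b where "b n k x = Bernstein n k (\<psi> x)" for n k x
  have b_cont: "continuous_on UNIV (b n k)" for n k
    unfolding b_def[abs_def] Bernstein_def \<psi>_def using K_pos by (auto intro!: continuous_intros)
  have b_nonneg: "0 \<le> L (b n k)" for n k
    using \<psi> by (intro nonneg b_cont) (auto simp: b_def intro!: Bernstein_nonneg)
  have b_sum: "(\<Sum>k\<le>n. L (b n k)) = 1" for n
    using sum[of "{..n}" "b n" "\<lambda>_. 1"] by (simp add: b_cont) (simp add: b_def one)
  \<comment> \<open>Half-open intervals are the ones used for tightness, so the left end moves to
    \<open>- K - 1\<close> in order to include the node \<open>- K\<close>. That node occurs for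
    \<open>k = 0\<close>, also when \<open>n = 0\<close>, where the quotient is 0.\<close>
  have node: "\<phi> (real k / real n) \<in> {- K - 1<..K}" if "k \<in> {..n}" for k n
  proof -
    have "0 \<le> real k / real n" "real k / real n \<le> 1"
      using that by (auto simp: divide_le_eq_1)
    then have "0 \<le> 2 * K * (real k / real n)" "2 * K * (real k / real n) \<le> 2 * K * 1"
      using K_pos by (intro mult_nonneg_nonneg mult_left_mono; simp)+
    then show ?thesis unfolding \<phi>_def greaterThanAtMost_iff using K_pos by linarith
  qed
  have "\<exists>\<nu>. real_distribution \<nu> \<and> measure \<nu> {- K - 1<..K} = 1 \<and>
     (\<forall>g :: real \<Rightarrow> real. g \<in> borel_measurable borel \<longrightarrow>
       (\<integral>x. g x \<partial>\<nu>) = (\<Sum>k\<le>n. L (b n k) * g (\<phi> (k / n))))" for n :: nat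
    by (rule finitely_supported_distribution[of "{..n}" "\<lambda>k. L (b n k)" "\<lambda>k. \<phi> (k / n)" "- K - 1" K])
      (use b_nonneg b_sum node in \<open>auto\<close>)
  then obtain \<nu> where \<nu>: "\<And>n. real_distribution (\<nu> n)" "\<And>n. measure (\<nu> n) {- K - 1<..K} = 1"
    "\<And>n (g :: real \<Rightarrow> real). g \<in> borel_measurable borel \<Longrightarrow>
       (\<integral>x. g x \<partial>\<nu> n) = (\<Sum>k\<le>n. L (b n k) * g (\<phi> (k / n)))"
    by metis
  \<comment> \<open>The integral against \<open>\<nu> n\<close> equals \<open>L\<close> applied to
    the transported Bernstein polynomial of \<open>g\<close>, which approximates \<open>g\<close>
    uniformly on \<open>{- K..K}\<close>.\<close>
  have conv: "(\<lambda>n. \<integral>x. g x \<partial>\<nu> n) \<longlonglongrightarrow> L g" if g: "continuous_on UNIV g" for g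
  proof (rule LIMSEQ_I)
    fix e :: real assume e: "0 < e"
    have "continuous_on {0..1} (\<lambda>t. g (\<phi> t))"
      unfolding \<phi>_def by (intro continuous_on_compose2[OF g] continuous_intros) simp
    from Bernstein_Weierstrass[OF this half_gt_zero[OF e]] obtain N where
      N: "\<And>n t. N \<le> n \<Longrightarrow> t \<in> {0..1} \<Longrightarrow>
        \<bar>g (\<phi> t) - (\<Sum>k\<le>n. g (\<phi> (k / n)) * Bernstein n k t)\<bar> < e / 2"
      by blast
    have "norm ((\<integral>x. g x \<partial>\<nu> n) - L g) < e" if "n \<ge> N" for n
    proof -
      have "(\<integral>x. g x \<partial>\<nu> n) = (\<Sum>k\<le>n. g (\<phi> (k / n)) * L (b n k))"
        using \<nu>(3)[OF borel_measurable_continuous_onI[OF g]] by (simp add: mult.commute)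
      also have "\<dots> = L (\<lambda>x. \<Sum>k\<le>n. g (\<phi> (k / n)) * b n k x)"
        by (rule sum[symmetric]) (simp_all add: b_cont)
      finally have "\<bar>L g - (\<integral>x. g x \<partial>\<nu> n)\<bar> \<le> e / 2"
        using N[OF that \<psi>] by (simp only:)
          (intro diff_le g continuous_intros continuous_on_subset[OF b_cont]; force simp: b_def \<phi>\<psi> intro: less_imp_le)
      then show ?thesis using e by (simp add: abs_minus_commute)
    qed
    then show "\<exists>N. \<forall>n\<ge>N. norm ((\<integral>x. g x \<partial>\<nu> n) - L g) < e" by blast
  qed
  \<comment> \<open>A single interval carries the full mass of all the measures.\<close>
  have "tight \<nu>"
    unfolding tight_def
  proof (intro conjI allI impI)
    fix e :: real assume "0 < e"
    then show "\<exists>a b. a < b \<and> (\<forall>n. 1 - e < measure (\<nu> n) {a<..b})"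
      using \<nu>(2) K_pos by (intro exI[of _ "- K - 1"] exI[of _ K]) simp
  qed (rule \<nu>(1))
  from tight_imp_convergent_subsubsequence[OF this strict_mono_id] obtain r \<kappa> where
    r: "strict_mono (r :: nat \<Rightarrow> nat)" and \<kappa>: "real_distribution \<kappa>" "weak_conv_m (\<nu> \<circ> r) \<kappa>"
    by auto
  have "(\<integral>x. g x \<partial>\<kappa>) = L g"
    if g: "continuous_on UNIV g" and C: "\<And>x. \<bar>g x\<bar> \<le> C" for g C
  proof (rule LIMSEQ_unique)
    have "(\<lambda>n. integral\<^sup>L ((\<nu> \<circ> r) n) g) \<longlonglongrightarrow> integral\<^sup>L \<kappa> g"
    proof (rule weak_conv_imp_integral_bdd_continuous_conv[OF _ \<kappa>])
      show "real_distribution ((\<nu> \<circ> r) n)" for n using \<nu>(1) by simp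
      show "isCont g x" for x using g by (simp add: continuous_on_eq_continuous_at)
      show "norm (g x) \<le> C" for x using C by simp
    qed
    then show "(\<lambda>n. integral\<^sup>L (\<nu> (r n)) g) \<longlonglongrightarrow> integral\<^sup>L \<kappa> g" by simp
    show "(\<lambda>n. integral\<^sup>L (\<nu> (r n)) g) \<longlonglongrightarrow> L g"
      using LIMSEQ_subseq_LIMSEQ[OF conv[OF g] r] by (simp add: o_def)
  qed
  then show thesis using that \<kappa>(1) by blast
qed

text \<open>Continuous functions may be unbounded. The measure found for bounded ones is
  concentrated on \<open>{- K..K}\<close>, so each \<open>g\<close> can be replaced by its clamped
  version.\<close>

lemma ex_measure:
  obtains \<kappa> where "real_distribution \<kappa>"
    "\<And>g. continuous_on UNIV g \<Longrightarrow> integrable \<kappa> g \<and> (\<integral>x. g x \<partial>\<kappa>) = L g"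
proof -
  obtain \<kappa> where \<kappa>: "real_distribution \<kappa>"
    and int: "\<And>g C. continuous_on UNIV g \<Longrightarrow> (\<And>x. \<bar>g x\<bar> \<le> C) \<Longrightarrow> (\<integral>x. g x \<partial>\<kappa>) = L g"
    using ex_measure_bounded by metis
  interpret real_distribution \<kappa> by fact
  \<comment> \<open>A bounded continuous function vanishing exactly on \<open>{- K..K}\<close>; its
    integral 0 rules out mass outside.\<close>
  define h where "h x = max 0 (min 1 (\<bar>x\<bar> - K))" for x
  have h: "continuous_on UNIV h" unfolding h_def by (intro continuous_intros)
  have h_meas [measurable]: "h \<in> borel_measurable borel" using h by (rule borel_measurable_continuous_onI)
  have h1: "\<bar>h x\<bar> \<le> 1" for x by (simp add: h_def)
  have "L h = L (\<lambda>_. 0)"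
    by (rule cong_interval[OF h]) (auto simp: h_def)
  then have "(\<integral>x. h x \<partial>\<kappa>) = 0" using int[OF h h1] by (simp add: const)
  moreover have "integrable \<kappa> h"
    by (rule integrable_const_bound[of _ 1]) (use h1 in auto)
  ultimately have "AE x in \<kappa>. h x = 0"
    by (subst integral_nonneg_eq_0_iff_AE[symmetric]) (simp_all, simp add: h_def)
  then have supp: "AE x in \<kappa>. x \<in> {- K..K}"
    by eventually_elim (auto simp: h_def max_def min_def split: if_splits)
  have "integrable \<kappa> g \<and> (\<integral>x. g x \<partial>\<kappa>) = L g" if g: "continuous_on UNIV g" for g
  proof -
    define k where "k x = g (max (- K) (min K x))" for x
    have k: "continuous_on UNIV k"
      unfolding k_def by (intro continuous_on_compose2[OF g] continuous_intros) simp
    have [measurable]: "k \<in> borel_measurable borel" "g \<in> borel_measurable borel"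
      using k g by (auto intro: borel_measurable_continuous_onI)
    obtain C where "\<And>x. x \<in> {- K..K} \<Longrightarrow> \<bar>g x\<bar> \<le> C"
      using continuous_bounded_on_interval[OF g] by blast
    then have C: "\<bar>k x\<bar> \<le> C" for x using K_pos by (simp add: k_def)
    have "integrable \<kappa> k" by (rule integrable_const_bound[of _ C]) (use C in auto)
    moreover have eq: "AE x in \<kappa>. k x = g x"
      using supp by eventually_elim (simp add: k_def)
    ultimately have "integrable \<kappa> g" by (subst integrable_cong_AE[symmetric, of k]) auto
    moreover have "(\<integral>x. g x \<partial>\<kappa>) = (\<integral>x. k x \<partial>\<kappa>)"
      by (rule integral_cong_AE) (use eq in auto)
    moreover have "L k = L g" by (rule cong_interval[OF k g]) (simp add: k_def)
    ultimately show ?thesis using int[OF k C] by simp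
  qed
  then show thesis using that \<kappa> by blast
qed

text \<open>Existence comes from \<open>ex_measure\<close> and uniqueness from
  \<open>real_distribution_eqI\<close>, so the definite description denotes this measure.\<close>

lemma integral_representing_measure:
  assumes F: "\<And>g. continuous_on UNIV g \<Longrightarrow> F g = complex_of_real (L g)"
    and g: "continuous_on UNIV g"
  shows "(\<integral>x. g x \<partial>representing_measure F) = L g"
proof -
  obtain \<kappa> where \<kappa>: "real_distribution \<kappa>"
    and int: "\<And>g. continuous_on UNIV g \<Longrightarrow> integrable \<kappa> g \<and> (\<integral>x. g x \<partial>\<kappa>) = L g"
    using ex_measure by blast
  have "representing_measure F = \<kappa>"
    unfolding representing_measure_def
  proof (rule the_equality)
    show "prob_space \<kappa> \<and> sets \<kappa> = sets borel \<and>
      (\<forall>g. continuous_on UNIV g \<longrightarrow> integrable \<kappa> g \<and> complex_of_real (\<integral>x. g x \<partial>\<kappa>) = F g)"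
      using \<kappa> int F by (auto simp: real_distribution_def real_distribution_axioms_def)
    fix \<mu>
    assume \<mu>: "prob_space \<mu> \<and> sets \<mu> = sets borel \<and>
      (\<forall>g. continuous_on UNIV g \<longrightarrow> integrable \<mu> g \<and> complex_of_real (\<integral>x. g x \<partial>\<mu>) = F g)"
    show "\<mu> = \<kappa>"
    proof (rule real_distribution_eqI[OF _ \<kappa>])
      show "real_distribution \<mu>"
        using \<mu> by (simp add: real_distribution_def real_distribution_axioms_def)
      fix g :: "real \<Rightarrow> real" assume g: "continuous_on UNIV g"
      then have "complex_of_real (\<integral>x. g x \<partial>\<mu>) = complex_of_real (\<integral>x. g x \<partial>\<kappa>)"
        using \<mu> F int by simp
      then show "(\<integral>x. g x \<partial>\<mu>) = (\<integral>x. g x \<partial>\<kappa>)" by (simp only: of_real_eq_iff)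
    qed
  qed
  then show ?thesis using int[OF g] by simp
qed

end

section \<open>Normalized traces as integrals\<close>

context real_symmetric_on
begin

text \<open>Positivity follows from the norm bound: if \<open>g\<close> takes values between 0 and
  \<open>C\<close> on the interval, then \<open>C - g\<close> is bounded by \<open>C\<close> there,
  so the average of \<open>g\<close> differs from \<open>C\<close> by at most
  \<open>C\<close>.\<close>

lemma averaged_positive_functional:
  assumes "W \<subseteq> S" "finite W" "W \<noteq> {}" "0 < K"
  shows "positive_functional (averaged W) K"
proof
  fix g :: "real \<Rightarrow> real" assume g: "continuous_on UNIV g" and pos: "\<And>x. x \<in> {- K..K} \<Longrightarrow> 0 \<le> g x"
  obtain C where "\<And>x. x \<in> {- K..K} \<Longrightarrow> \<bar>g x\<bar> \<le> C"
    using continuous_bounded_on_interval[OF g] by blast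
  then have "\<bar>C - g x\<bar> \<le> C" if "x \<in> {- K..K}" for x
    using pos[OF that] that by fastforce
  then have "\<bar>averaged W (\<lambda>_. C * 1) - averaged W g\<bar> \<le> C"
    by (intro averaged_diff_le assms g) (auto intro: continuous_intros)
  then show "0 \<le> averaged W g"
    using averaged_scale[of "\<lambda>_. 1" W C] averaged_1[OF assms(1-3)] by simp
qed (use assms averaged_add averaged_scale averaged_1 in simp_all)

lemma integral_averaged_trace:
  assumes "W \<subseteq> S" "finite W" "W \<noteq> {}" "0 < K" "continuous_on UNIV g"
  shows "(\<integral>x. g x \<partial>representing_measure (\<lambda>g. 1 / of_nat (card W) * trace_on W (cfc_on S A g))) = averaged W g"
  using positive_functional.integral_representing_measure[OF averaged_positive_functional[OF assms(1-4)]
      trace_cfc assms(5)] .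

end

subsection \<open>Schroedinger operators\<close>

lift_definition shift :: "int \<Rightarrow> ell2 \<Rightarrow> ell2" is "\<lambda>k u n. u (n + k)"
  by (rule ell2_summable_shift)

lemma coord_shift [simp]: "coord (shift k u) n = coord u (n + k)"
  by (simp add: shift.rep_eq)

lemma infsum_int_shift:
  fixes h :: "int \<Rightarrow> 'b::{topological_comm_monoid_add, t2_space}"
  shows "(\<Sum>\<^sub>\<infinity>n. h (n + k)) = (\<Sum>\<^sub>\<infinity>n. h n)"
  by (rule infsum_reindex_bij_betw) (rule bij_betw_byWitness[of _ "\<lambda>n. n - k"], auto)

lemma norm_shift: "norm (shift k u) = norm u"
  using infsum_int_shift[of "\<lambda>n. (cmod (coord u n))\<^sup>2" k] by (simp add: norm_ell2)

lemma inner_shift: "inner (shift k u) v = inner u (shift (- k) v)"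
  using infsum_int_shift[of "\<lambda>n. inner (coord u n) (coord v (n - k))" k]
  by (simp add: inner_ell2.rep_eq)

lemma shift_delta: "shift k (delta m) = delta (m - k)"
  by (rule ell2_eqI) (auto simp: coord_delta)

locale bounded_potential =
  fixes V :: "int \<Rightarrow> real" and C :: real
  assumes V_le: "\<bar>V n\<bar> \<le> C"
begin

lemma bounded_V: "bounded (range V)"
  using V_le by (auto intro!: boundedI[of _ C])

lemma C_nonneg: "0 \<le> C"
  using V_le[of 0] by simp

lemmas coord_H = coord_schroedinger[OF bounded_V]

text \<open>The diagonal part is obtained by subtracting the two translations, so that its
  square-summability is inherited.\<close>

definition mult_V :: "ell2 \<Rightarrow> ell2" where
  "mult_V u = blinfun_apply (schroedinger V) u - shift (- 1) u - shift 1 u"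

lemma coord_mult_V: "coord (mult_V u) n = complex_of_real (V n) * coord u n"
  by (simp add: mult_V_def coord_H)

lemma H_decomposition: "blinfun_apply (schroedinger V) u = shift (- 1) u + shift 1 u + mult_V u"
  by (simp add: mult_V_def)

lemma norm_mult_V: "norm (mult_V u) \<le> C * norm u"
proof -
  have "(\<Sum>\<^sub>\<infinity>n. (cmod (coord (mult_V u) n))\<^sup>2) \<le> (\<Sum>\<^sub>\<infinity>n. C\<^sup>2 * (cmod (coord u n))\<^sup>2)"
  proof (rule infsum_mono)
    show "(cmod (coord (mult_V u) n))\<^sup>2 \<le> C\<^sup>2 * (cmod (coord u n))\<^sup>2" for n
      using power_mono[OF V_le[of n], of 2]
      by (simp add: coord_mult_V norm_mult power_mult_distrib mult_right_mono)
  qed (intro summable_on_cmult_right coord_summable)+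
  also have "\<dots> = C\<^sup>2 * (\<Sum>\<^sub>\<infinity>n. (cmod (coord u n))\<^sup>2)" by (rule infsum_cmult_right')
  finally have "norm (mult_V u) \<le> sqrt (C\<^sup>2 * (\<Sum>\<^sub>\<infinity>n. (cmod (coord u n))\<^sup>2))"
    by (simp add: norm_ell2)
  then show ?thesis using C_nonneg by (simp add: norm_ell2 real_sqrt_mult)
qed

lemma inner_mult_V: "inner (mult_V u) v = inner u (mult_V v)"
  unfolding inner_ell2.rep_eq coord_mult_V
  by (intro infsum_cong) (simp add: inner_complex_def algebra_simps)

lemma norm_H: "norm (schroedinger V) \<le> 2 + C"
proof (rule norm_blinfun_bound)
  fix u
  have "norm (blinfun_apply (schroedinger V) u) \<le> norm (shift (- 1) u) + norm (shift 1 u) + norm (mult_V u)"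
    unfolding H_decomposition by (rule order_trans[OF norm_triangle_ineq add_right_mono[OF norm_triangle_ineq]])
  also have "\<dots> \<le> (2 + C) * norm u"
    using norm_mult_V[of u] by (simp add: norm_shift algebra_simps)
  finally show "norm (blinfun_apply (schroedinger V) u) \<le> (2 + C) * norm u" .
qed (use C_nonneg in simp)

lemma inner_H: "inner (blinfun_apply (schroedinger V) u) v = inner u (blinfun_apply (schroedinger V) v)"
  by (simp add: H_decomposition inner_add_left inner_add_right inner_shift inner_mult_V)

lemma H_real: "u \<in> real_ell2 \<Longrightarrow> blinfun_apply (schroedinger V) u \<in> real_ell2"
  by (simp add: real_ell2_def coord_H)



text \<open>The two translations are isometries and contribute 2, the potential contributes
  \<open>C\<close>.\<close>

sublocale H: real_symmetric_on UNIV "schroedinger V" "2 + C"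
  by standard (simp_all add: inner_H H_real norm_H)

text \<open>Projections have norm at most 1, so every compression obeys the same bound as the full
  operator.\<close>

sublocale compressed: real_symmetric_on W "compress W (schroedinger V)" "2 + C" for W
proof
  have "norm (compress W (schroedinger V)) \<le> norm (proj W) * norm (schroedinger V) * norm (proj W)"
    unfolding compress_def
    by (intro order_trans[OF norm_blinfun_compose] mult_right_mono norm_blinfun_compose) simp
  also have "\<dots> \<le> 1 * norm (schroedinger V) * 1"
    by (intro mult_mono norm_proj_le order_refl) simp_all
  finally show "norm (compress W (schroedinger V)) \<le> 2 + C" using norm_H by simp
qed (simp_all add: compress_def proj_symmetric inner_H proj_ell2_on proj_real H_real)

lemma H_ell2_on:
  assumes "u \<in> ell2_on {m - int j..m + int j}"
  shows "blinfun_apply (schroedinger V) u \<in> ell2_on {m - int (Suc j)..m + int (Suc j)}"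
  using assms by (auto simp: ell2_on_def coord_H)

text \<open>Finite propagation: each application enlarges the support by one site on either side. As
  long as the sites reached lie in \<open>W\<close>, the projections act as the identity.\<close>

lemma compress_funpow_delta:
  assumes "{m - int k..m + int k} \<subseteq> W" "j \<le> k"
  shows "(blinfun_apply (compress W (schroedinger V)) ^^ j) (delta m) = (blinfun_apply (schroedinger V) ^^ j) (delta m)
    \<and> (blinfun_apply (schroedinger V) ^^ j) (delta m) \<in> ell2_on {m - int j..m + int j}"
  using assms(2)
proof (induction j)
  case 0
  then show ?case by (simp add: delta_in_ell2_on)
next
  case (Suc j)
  let ?u = "(blinfun_apply (schroedinger V) ^^ j) (delta m)"
  have sub: "u \<in> ell2_on W" if "u \<in> ell2_on {m - int i..m + int i}" "i \<le> k" for u i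
  proof -
    have "{m - int i..m + int i} \<subseteq> W" using assms(1) that(2) by fastforce
    then show ?thesis using that(1) unfolding ell2_on_def by blast
  qed
  have u: "?u \<in> ell2_on {m - int j..m + int j}" using Suc by simp
  note Hu = H_ell2_on[OF u]
  show ?case
    using Suc sub[OF u] sub[OF Hu] Hu by (simp add: compress_def proj_eq)
qed

lemma poly_op_compress_delta:
  assumes "{m - int (degree p)..m + int (degree p)} \<subseteq> W"
  shows "blinfun_apply (poly_op p (compress W (schroedinger V))) (delta m) = blinfun_apply (poly_op p (schroedinger V)) (delta m)"
  using compress_funpow_delta[OF assms] by (simp add: poly_op_apply)

end

section \<open>Windows and the two families of measures\<close>

lemma card_window: "card (window s N) = N"
  by (cases s) simp_all

lemma finite_window: "finite (window s N)"
  by (cases s) simp_all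

lemma window_nonempty: "0 < N \<Longrightarrow> window s N \<noteq> {}"
  using card_window[of s N] by (metis card.empty less_numeral_extra(3))

lemma window_eq: obtains a where "window s N = {a..<a + int N}"
  by (cases s) (auto intro: that[of 0] that[of "- int N"])

lemma trace_on_compress: "trace_on W (compress W B) = trace_on W B"
  unfolding trace_on_def
  by (intro sum.cong) (simp_all add: compress_def coord_proj proj_eq delta_in_ell2_on)

context bounded_potential
begin

lemma integral_dk:
  assumes "0 < N" "continuous_on UNIV g"
  shows "(\<integral>x. g x \<partial>dk (schroedinger V) s N) = H.averaged (window s N) g"
  using H.integral_averaged_trace[of "window s N" g] assms C_nonneg
  by (simp add: dk_def trace_on_compress card_window finite_window window_nonempty)

lemma integral_dk_tilde:
  assumes "0 < N" "continuous_on UNIV g"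
  shows "(\<integral>x. g x \<partial>dk_tilde (schroedinger V) s N) = compressed.averaged (window s N) (window s N) g"
  using compressed.integral_averaged_trace[of "window s N" "window s N" g] assms C_nonneg
  by (simp add: dk_tilde_def card_window finite_window window_nonempty)

definition site :: "real poly \<Rightarrow> int \<Rightarrow> real" where
  "site p n = inner (delta n) (blinfun_apply (poly_op p (schroedinger V)) (delta n))"

lemma integral_dk_poly:
  assumes "0 < N"
  shows "(\<integral>x. poly p x \<partial>dk (schroedinger V) s N) = (\<Sum>n\<in>window s N. site p n) / N"
  using integral_dk[OF assms, of "poly p"] H.averaged_poly[of "window s N" p]
  by (simp add: continuous_on_poly card_window site_def)

lemma integral_dk_abs_le:
  fixes g h :: "real \<Rightarrow> real"
  assumes "0 < N" "continuous_on UNIV g" "\<And>x. x \<in> {- (2 + C)..2 + C} \<Longrightarrow> \<bar>g x\<bar> \<le> c"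
  shows "\<bar>\<integral>x. g x \<partial>dk (schroedinger V) s N\<bar> \<le> c"
  unfolding integral_dk[OF assms(1,2)]
  by (rule H.averaged_abs_le) (use assms in \<open>auto simp: finite_window window_nonempty\<close>)

lemma integral_dk_diff_le:
  fixes g h :: "real \<Rightarrow> real"
  assumes "0 < N" "continuous_on UNIV g" "continuous_on UNIV h"
    "\<And>x. x \<in> {- (2 + C)..2 + C} \<Longrightarrow> \<bar>g x - h x\<bar> \<le> c"
  shows "\<bar>(\<integral>x. g x \<partial>dk (schroedinger V) s N) - (\<integral>x. h x \<partial>dk (schroedinger V) s N)\<bar> \<le> c"
  unfolding integral_dk[OF assms(1,2)] integral_dk[OF assms(1,3)]
  by (rule H.averaged_diff_le) (use assms in \<open>auto simp: finite_window window_nonempty\<close>)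

lemma integral_dk_tilde_diff_le:
  fixes g h :: "real \<Rightarrow> real"
  assumes "0 < N" "continuous_on UNIV g" "continuous_on UNIV h"
    "\<And>x. x \<in> {- (2 + C)..2 + C} \<Longrightarrow> \<bar>g x - h x\<bar> \<le> c"
  shows "\<bar>(\<integral>x. g x \<partial>dk_tilde (schroedinger V) s N) - (\<integral>x. h x \<partial>dk_tilde (schroedinger V) s N)\<bar> \<le> c"
  unfolding integral_dk_tilde[OF assms(1,2)] integral_dk_tilde[OF assms(1,3)]
  by (rule compressed.averaged_diff_le) (use assms in \<open>auto simp: finite_window window_nonempty\<close>)

text \<open>Only sites closer to an end of the window than the degree feel the restriction. There
  are at most \<open>2 * degree p\<close> of them, each contributing at most \<open>2 * c\<close>,
  against the normalization by \<open>N\<close>.\<close>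

lemma integral_dk_tilde_poly_diff:
  "(\<lambda>N. (\<integral>x. poly p x \<partial>dk_tilde (schroedinger V) s N) - (\<integral>x. poly p x \<partial>dk (schroedinger V) s N)) \<longlonglongrightarrow> 0"
proof -
  obtain c where c: "\<And>x. x \<in> {- (2 + C)..2 + C} \<Longrightarrow> \<bar>poly p x\<bar> \<le> c"
    using continuous_bounded_on_interval[where g = "poly p", OF continuous_on_poly[OF continuous_on_id]]
    by blast
  let ?d = "degree p"
  have bound: "norm ((\<integral>x. poly p x \<partial>dk_tilde (schroedinger V) s N) - (\<integral>x. poly p x \<partial>dk (schroedinger V) s N))
      \<le> (4 * ?d * c) / real N" if N: "0 < N" for N
  proof -
    let ?W = "window s N"
    define t where "t n = inner (delta n) (blinfun_apply (poly_op p (compress ?W (schroedinger V))) (delta n))" for n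
    obtain a where a: "?W = {a..<a + int N}" by (rule window_eq)
    \<comment> \<open>The intersection with the window covers short windows, whose boundary strips
      may overlap or stick out.\<close>
    define Z where "Z = ?W \<inter> ({a..<a + int ?d} \<union> {a + int N - int ?d..<a + int N})"
    have "card Z \<le> card ({a..<a + int ?d} \<union> {a + int N - int ?d..<a + int N})"
      unfolding Z_def by (intro card_mono) auto
    also have "\<dots> \<le> 2 * ?d" by (rule order_trans[OF card_Un_le]) simp
    finally have cardZ: "card Z \<le> 2 * ?d" .
    have c0: "0 \<le> c" using c[of 0] C_nonneg by simp
    have inside: "t n = site p n" if "n \<in> ?W - Z" for n
    proof -
      have "{n - int ?d..n + int ?d} \<subseteq> ?W" using that unfolding Z_def a by auto
      then show ?thesis by (simp add: t_def site_def poly_op_compress_delta)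
    qed
    have each: "\<bar>t n - site p n\<bar> \<le> 2 * c" if "n \<in> ?W" for n
    proof -
      have "\<bar>t n\<bar> \<le> c" unfolding t_def by (rule compressed.inner_delta_poly_op_le[OF that c])
      moreover have "\<bar>site p n\<bar> \<le> c"
        unfolding site_def by (rule H.inner_delta_poly_op_le[OF _ c]) simp
      ultimately show ?thesis by linarith
    qed
    have "\<bar>(\<Sum>n\<in>?W. t n) - (\<Sum>n\<in>?W. site p n)\<bar> = \<bar>\<Sum>n\<in>?W. t n - site p n\<bar>"
      by (simp add: sum_subtractf)
    also have "(\<Sum>n\<in>?W. t n - site p n) = (\<Sum>n\<in>Z. t n - site p n)"
      using inside by (intro sum.mono_neutral_right) (auto simp: Z_def finite_window)
    also have "\<bar>\<Sum>n\<in>Z. t n - site p n\<bar> \<le> real (card Z) * (2 * c)"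
      by (rule order_trans[OF sum_abs sum_bounded_above]) (auto intro: each simp: Z_def)
    also have "\<dots> \<le> real (2 * ?d) * (2 * c)"
      using c0 cardZ by (intro mult_right_mono) linarith+
    finally have "\<bar>(\<Sum>n\<in>?W. t n) - (\<Sum>n\<in>?W. site p n)\<bar> \<le> 4 * ?d * c" by simp
    moreover have "(\<integral>x. poly p x \<partial>dk_tilde (schroedinger V) s N) = (\<Sum>n\<in>?W. t n) / N"
      using integral_dk_tilde[OF N, of "poly p"] compressed.averaged_poly[of ?W ?W p]
      by (simp add: continuous_on_poly card_window t_def)
    ultimately show ?thesis
      by (simp add: integral_dk_poly[OF N] diff_divide_distrib[symmetric] divide_right_mono)
  qed
  show ?thesis
  proof (rule Lim_null_comparison)
    show "\<forall>\<^sub>F N in sequentially. norm ((\<integral>x. poly p x \<partial>dk_tilde (schroedinger V) s N)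
        - (\<integral>x. poly p x \<partial>dk (schroedinger V) s N)) \<le> (4 * ?d * c) / real N"
      using eventually_gt_at_top[of 0] by eventually_elim (rule bound)
  qed (rule lim_const_over_n)
qed

text \<open>Replacing \<open>g\<close> by a polynomial within \<open>e / 3\<close> on the common
  interval moves both integrals by at most \<open>e / 3\<close>, uniformly in
  \<open>N\<close>.\<close>

lemma integral_dk_tilde_diff:
  fixes g h :: "real \<Rightarrow> real"
  assumes g: "continuous_on UNIV g"
  shows "(\<lambda>N. (\<integral>x. g x \<partial>dk_tilde (schroedinger V) s N) - (\<integral>x. g x \<partial>dk (schroedinger V) s N)) \<longlonglongrightarrow> 0"
proof (rule tendstoI)
  fix e :: real assume "0 < e"
  then have e: "0 < e / 3" by simp
  obtain p where p: "\<And>x. x \<in> {- (2 + C)..2 + C} \<Longrightarrow> \<bar>g x - poly p x\<bar> < e / 3"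
    using real_poly_uniform_approx[OF continuous_on_subset[OF g] e] by (metis subset_UNIV)
  show "\<forall>\<^sub>F N in sequentially. dist ((\<integral>x. g x \<partial>dk_tilde (schroedinger V) s N)
      - (\<integral>x. g x \<partial>dk (schroedinger V) s N)) 0 < e"
    using tendstoD[OF integral_dk_tilde_poly_diff[where p = p and s = s] e] eventually_gt_at_top[of 0]
  proof eventually_elim
    case (elim N)
    have "\<bar>(\<integral>x. g x \<partial>dk (schroedinger V) s N) - (\<integral>x. poly p x \<partial>dk (schroedinger V) s N)\<bar> \<le> e / 3"
      "\<bar>(\<integral>x. g x \<partial>dk_tilde (schroedinger V) s N) - (\<integral>x. poly p x \<partial>dk_tilde (schroedinger V) s N)\<bar> \<le> e / 3"
      using p elim(2) by (intro integral_dk_diff_le integral_dk_tilde_diff_le g;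
        force intro: less_imp_le continuous_on_poly)+
    with elim(1) show ?case unfolding dist_real_def by linarith
  qed
qed

end

section \<open>Translation of the potential by one site\<close>

lemma bounded_potential_Suc: "bounded_potential V C \<Longrightarrow> bounded_potential (\<lambda>n. V (n + 1)) C"
  by (simp add: bounded_potential_def)

text \<open>Translation by one site intertwines the two Schroedinger operators, hence also
  polynomials in them, and carries \<open>delta (n + 1)\<close> to \<open>delta n\<close>.\<close>

lemma site_shift:
  assumes "bounded_potential V C"
  shows "bounded_potential.site (\<lambda>n. V (n + 1)) p n = bounded_potential.site V p (n + 1)"
proof -
  interpret bounded_potential V C by fact
  interpret V': bounded_potential "\<lambda>n. V (n + 1)" C by (rule bounded_potential_Suc) fact
  have "shift 1 (blinfun_apply (schroedinger V) u) = blinfun_apply (schroedinger (\<lambda>n. V (n + 1))) (shift 1 u)" for u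
    by (rule ell2_eqI) (simp add: coord_H V'.coord_H algebra_simps)
  moreover have "shift 1 (u + v) = shift 1 u + shift 1 v" "shift 1 (c *\<^sub>R u) = c *\<^sub>R shift 1 u" for u v c
    by (rule ell2_eqI; simp)+
  moreover have "shift 1 0 = 0" by (rule ell2_eqI) simp
  ultimately have "shift 1 (blinfun_apply (poly_op p (schroedinger V)) u)
      = blinfun_apply (poly_op p (schroedinger (\<lambda>n. V (n + 1)))) (shift 1 u)" for u
    by (induction p) simp_all
  from this[of "delta (n + 1)"] show ?thesis
    unfolding site_def V'.site_def inner_delta by (metis add_diff_cancel_right' coord_shift shift_delta)
qed

text \<open>The window sums for the two potentials telescope to a difference of two end terms, each
  at most \<open>c\<close> in absolute value.\<close>

lemma integral_dk_poly_shift: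
  assumes "bounded_potential V C"
  shows "(\<lambda>N. (\<integral>x. poly p x \<partial>dk (schroedinger (\<lambda>n. V (n + 1))) s N)
    - (\<integral>x. poly p x \<partial>dk (schroedinger V) s N)) \<longlonglongrightarrow> 0"
proof -
  interpret bounded_potential V C by fact
  interpret V': bounded_potential "\<lambda>n. V (n + 1)" C by (rule bounded_potential_Suc) fact
  obtain c where c: "\<And>x. x \<in> {- (2 + C)..2 + C} \<Longrightarrow> \<bar>poly p x\<bar> \<le> c"
    using continuous_bounded_on_interval[where g = "poly p", OF continuous_on_poly[OF continuous_on_id]]
    by blast
  have site: "\<bar>site p n\<bar> \<le> c" for n
    unfolding site_def by (rule H.inner_delta_poly_op_le[OF _ c]) simp
  have tele: "(\<Sum>n\<in>{a..<a + int N}. site p (n + 1)) - (\<Sum>n\<in>{a..<a + int N}. site p n) = site p (a + int N) - site p a" for a N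
  proof (induction N)
    case (Suc N)
    have "{a..<a + int (Suc N)} = insert (a + int N) {a..<a + int N}" by auto
    with Suc show ?case by (simp add: algebra_simps)
  qed simp
  have bound: "norm ((\<integral>x. poly p x \<partial>dk (schroedinger (\<lambda>n. V (n + 1))) s N) - (\<integral>x. poly p x \<partial>dk (schroedinger V) s N))
      \<le> (2 * c) / real N" if N: "0 < N" for N
  proof -
    obtain a where a: "window s N = {a..<a + int N}" by (rule window_eq)
    have "\<bar>site p (a + int N) - site p a\<bar> \<le> 2 * c" using site[of "a + int N"] site[of a] by linarith
    then show ?thesis
      by (simp add: integral_dk_poly[OF N] V'.integral_dk_poly[OF N] site_shift[OF assms] a
          diff_divide_distrib[symmetric] divide_right_mono tele)
  qed
  show ?thesis
  proof (rule Lim_null_comparison)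
    show "\<forall>\<^sub>F N in sequentially. norm ((\<integral>x. poly p x \<partial>dk (schroedinger (\<lambda>n. V (n + 1))) s N)
        - (\<integral>x. poly p x \<partial>dk (schroedinger V) s N)) \<le> (2 * c) / real N"
      using eventually_gt_at_top[of 0] by eventually_elim (rule bound)
  qed (rule lim_const_over_n)
qed

subsection \<open>Ergodicity\<close>

text \<open>Every sublevel set of \<open>F\<close> at a rational level is invariant, hence null or
  conull. Outside a countable union of null sets all points lie in the same sublevel sets, and these
  determine the value of \<open>F\<close>.\<close>

lemma ergodic_imp_AE_const:
  fixes F :: "'a \<Rightarrow> ereal"
  assumes erg: "ergodic_map M T" and F [measurable]: "F \<in> borel_measurable M"
    and inv: "\<And>\<omega>. \<omega> \<in> space M \<Longrightarrow> F (T \<omega>) = F \<omega>"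
  shows "\<exists>d. AE \<omega> in M. F \<omega> = d"
proof -
  define P where "P q \<longleftrightarrow> (AE \<omega> in M. F \<omega> \<le> ereal (of_rat q))" for q
  have T: "T \<in> measurable M M" using erg by (simp add: ergodic_map_def)
  have "AE \<omega> in M. F \<omega> \<le> ereal (of_rat q) \<longleftrightarrow> P q" for q
  proof -
    let ?E = "{\<omega> \<in> space M. F \<omega> \<le> ereal (of_rat q)}"
    have "T -` ?E \<inter> space M = ?E" using inv measurable_space[OF T] by auto
    moreover have E: "?E \<in> sets M" by measurable
    ultimately consider "emeasure M ?E = 0" | "emeasure M (space M - ?E) = 0"
      using erg unfolding ergodic_map_def by metis
    then show ?thesis
    proof cases
      case 1
      then have "AE \<omega> in M. \<not> F \<omega> \<le> ereal (of_rat q)"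
        by (intro AE_I[of _ _ ?E]) (use E in auto)
      then show ?thesis by (cases "P q") (simp_all add: P_def)
    next
      case 2
      then have "AE \<omega> in M. F \<omega> \<le> ereal (of_rat q)"
        by (intro AE_I[of _ _ "space M - ?E"]) (use E in auto)
      then show ?thesis by (simp add: P_def)
    qed
  qed
  then have AE: "AE \<omega> in M. \<forall>q. F \<omega> \<le> ereal (of_rat q) \<longleftrightarrow> P q"
    by (simp add: AE_all_countable)
  show ?thesis
  proof (cases "\<exists>\<omega>0. \<forall>q. F \<omega>0 \<le> ereal (of_rat q) \<longleftrightarrow> P q")
    case True
    then obtain \<omega>0 where \<omega>0: "\<And>q. F \<omega>0 \<le> ereal (of_rat q) \<longleftrightarrow> P q" by blast
    have "F \<omega> = F \<omega>0" if "\<forall>q. F \<omega> \<le> ereal (of_rat q) \<longleftrightarrow> P q" for \<omega>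
    proof (rule ccontr)
      assume "F \<omega> \<noteq> F \<omega>0"
      then consider "F \<omega> < F \<omega>0" | "F \<omega>0 < F \<omega>" by fastforce
      then show False
        by cases (metis ereal_dense3 \<omega>0 that less_imp_le not_le)+
    qed
    with AE have "AE \<omega> in M. F \<omega> = F \<omega>0" by (rule eventually_mono)
    then show ?thesis by blast
  next
    case False
    \<comment> \<open>If no point at all has the prescribed sublevel pattern, almost every point
      being of that kind means that the whole space is null, and any constant will do.\<close>
    have "AE \<omega> in M. False" using AE by (rule eventually_mono) (use False in blast)
    then have "AE \<omega> in M. F \<omega> = 0" by (rule eventually_mono) simp
    then show ?thesis by blast
  qed
qed

lemma int_iterate_step:
  assumes "invertible_map M T" "\<omega> \<in> space M"
  shows "int_iterate M T n (T \<omega>) = int_iterate M T (n + 1) \<omega>"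
proof -
  define S where "S = the_inv_into (space M) T"
  have ST: "S (T \<omega>) = \<omega>"
    using assms unfolding S_def invertible_map_def by (intro the_inv_into_f_f) (auto simp: bij_betw_def)
  show ?thesis
  proof (cases "n \<ge> 0")
    case True
    then show ?thesis by (simp add: int_iterate_def nat_add_distrib funpow_swap1)
  next
    case False
    then obtain k where "n = - int (Suc k)" by (metis int_cases nat_int of_nat_0_le_iff)
    then show ?thesis
      \<comment> \<open>For \<open>k = 0\<close> the index \<open>n + 1\<close> is 0 and falls into
        the nonnegative branch of \<open>int_iterate\<close>; otherwise one inverse cancels against
        \<open>T\<close>.\<close>
      by (cases k) (simp_all add: int_iterate_def S_def[symmetric] funpow_swap1 ST nat_add_distrib)
  qed
qed

lemma measurable_funpow: "T \<in> measurable M M \<Longrightarrow> T ^^ n \<in> measurable M M"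
  by (induction n) (auto intro: measurable_comp simp: measurable_ident[unfolded id_def] id_def)

lemma measurable_int_iterate:
  assumes "invertible_map M T"
  shows "int_iterate M T n \<in> measurable M M"
  using assms by (simp add: int_iterate_def invertible_map_def measurable_funpow)

text \<open>The index 0 is excluded because the empty window gives no probability measure, so
  nothing is known about that term.\<close>

lemma liminf_limsup_le_add:
  fixes a b :: "nat \<Rightarrow> real"
  assumes "\<And>n. 0 < n \<Longrightarrow> a n \<le> b n + e"
  shows "liminf (\<lambda>n. ereal (a n)) \<le> liminf (\<lambda>n. ereal (b n)) + ereal e"
    and "limsup (\<lambda>n. ereal (a n)) \<le> limsup (\<lambda>n. ereal (b n)) + ereal e"
proof -
  have ev: "\<forall>\<^sub>F n in sequentially. ereal (a n) \<le> ereal e + ereal (b n)"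
    using eventually_gt_at_top[of 0] by eventually_elim (simp add: assms add.commute[of e])
  show "liminf (\<lambda>n. ereal (a n)) \<le> liminf (\<lambda>n. ereal (b n)) + ereal e"
    using Liminf_mono[OF ev] ereal_liminf_lim_add[OF tendsto_const, of "ereal e" "\<lambda>n. ereal (b n)"]
    by (simp add: add.commute)
  show "limsup (\<lambda>n. ereal (a n)) \<le> limsup (\<lambda>n. ereal (b n)) + ereal e"
    using Limsup_mono[OF ev] ereal_limsup_lim_add[OF tendsto_const, of "ereal e" "\<lambda>n. ereal (b n)"]
    by (simp add: add.commute)
qed

lemma liminf_limsup_eq_of_diff:
  fixes a b :: "nat \<Rightarrow> real"
  assumes "(\<lambda>n. a n - b n) \<longlonglongrightarrow> 0"
  shows "liminf (\<lambda>n. ereal (a n)) = liminf (\<lambda>n. ereal (b n))"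
    and "limsup (\<lambda>n. ereal (a n)) = limsup (\<lambda>n. ereal (b n))"
proof -
  have lim: "(\<lambda>n. ereal (a n - b n)) \<longlonglongrightarrow> ereal 0" using assms by simp
  have eq: "(\<lambda>n. ereal (a n - b n) + ereal (b n)) = (\<lambda>n. ereal (a n))" by simp
  show "liminf (\<lambda>n. ereal (a n)) = liminf (\<lambda>n. ereal (b n))"
    using ereal_liminf_lim_add[OF lim, of "\<lambda>n. ereal (b n)"] by (simp add: eq)
  show "limsup (\<lambda>n. ereal (a n)) = limsup (\<lambda>n. ereal (b n))"
    using ereal_limsup_lim_add[OF lim, of "\<lambda>n. ereal (b n)"] by (simp add: eq)
qed

lemma liminf_limsup_finite:
  fixes a :: "nat \<Rightarrow> real"
  assumes "\<And>n. 0 < n \<Longrightarrow> \<bar>a n\<bar> \<le> c"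
  shows "\<bar>liminf (\<lambda>n. ereal (a n))\<bar> \<noteq> \<infinity>" and "\<bar>limsup (\<lambda>n. ereal (a n))\<bar> \<noteq> \<infinity>"
proof -
  have le: "- c \<le> a n" "a n \<le> c" if "0 < n" for n
    using assms[OF that] by auto
  have "\<forall>\<^sub>F n in sequentially. ereal (- c) \<le> ereal (a n)"
    using eventually_gt_at_top[of 0] by eventually_elim (simp add: le)
  then have 1: "ereal (- c) \<le> liminf (\<lambda>n. ereal (a n))" by (rule Liminf_bounded)
  have "\<forall>\<^sub>F n in sequentially. ereal (a n) \<le> ereal c"
    using eventually_gt_at_top[of 0] by eventually_elim (simp add: le)
  then have 2: "limsup (\<lambda>n. ereal (a n)) \<le> ereal c" by (rule Limsup_bounded)
  have 3: "liminf (\<lambda>n. ereal (a n)) \<le> limsup (\<lambda>n. ereal (a n))"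
    by (rule Liminf_le_Limsup) simp
  show "\<bar>liminf (\<lambda>n. ereal (a n))\<bar> \<noteq> \<infinity>" "\<bar>limsup (\<lambda>n. ereal (a n))\<bar> \<noteq> \<infinity>"
    using 1 2 3 by (cases "liminf (\<lambda>n. ereal (a n))"; cases "limsup (\<lambda>n. ereal (a n))"; simp)+
qed

text \<open>Coefficient lists over \<open>rat\<close> form a countable type, which lets almost
  everywhere statements be combined over all of them.\<close>

definition rat_poly :: "rat list \<Rightarrow> real poly" where
  "rat_poly l = Poly (map of_rat l)"

text \<open>Coefficients are perturbed one at a time: the constant term uses up less than
  \<open>e / 2\<close>, the tail at most \<open>e / 2\<close> after multiplication by
  \<open>x\<close>. The factor \<open>K + 1\<close> covers \<open>K = 0\<close>.\<close>

lemma rat_poly_approx: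
  assumes "0 < e" "0 \<le> K"
  shows "\<exists>l. \<forall>x\<in>{- K..K}. \<bar>poly p x - poly (rat_poly l) x\<bar> < e"
  using assms(1)
proof (induction p arbitrary: e)
  case 0
  then show ?case by (intro exI[of _ "[]"]) (simp add: rat_poly_def)
next
  case (pCons a p)
  have "0 < e / (2 * (K + 1))" using pCons.prems assms(2) by simp
  from pCons.IH[OF this] obtain l where
    l: "\<And>x. x \<in> {- K..K} \<Longrightarrow> \<bar>poly p x - poly (rat_poly l) x\<bar> < e / (2 * (K + 1))"
    by blast
  obtain r where r: "a - e / 2 < of_rat r" "of_rat r < a"
    using of_rat_dense[of "a - e / 2" a] pCons.prems by auto
  have "\<bar>poly (pCons a p) x - poly (rat_poly (r # l)) x\<bar> < e" if x: "x \<in> {- K..K}" for x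
  proof -
    let ?d = "poly p x - poly (rat_poly l) x"
    have "\<bar>x * ?d\<bar> \<le> (K + 1) * (e / (2 * (K + 1)))"
      unfolding abs_mult using x l[OF x] assms(2) by (intro mult_mono) auto
    also have "\<dots> = e / 2" using assms(2) by (simp add: field_simps)
    finally have "\<bar>x * ?d\<bar> \<le> e / 2" .
    moreover have "poly (pCons a p) x - poly (rat_poly (r # l)) x = (a - of_rat r) + x * ?d"
      by (simp add: rat_poly_def algebra_simps)
    ultimately show ?thesis using r by linarith
  qed
  then show ?case by blast
qed

text \<open>One Horner step expresses coordinate \<open>n\<close> through the coordinates
  \<open>n - 1\<close>, \<open>n\<close>, \<open>n + 1\<close> of the previous vector and the
  potential at \<open>n\<close>. The induction therefore runs over all \<open>n\<close> at
  once.\<close>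

lemma measurable_coord_poly_op_hamiltonian:
  assumes T: "invertible_map M T" and f [measurable]: "f \<in> borel_measurable M"
    and bd: "\<And>\<omega>. \<omega> \<in> space M \<Longrightarrow> bounded (range (\<lambda>n. f (int_iterate M T n \<omega>)))"
  shows "(\<lambda>\<omega>. coord (blinfun_apply (poly_op p (hamiltonian M T f \<omega>)) (delta m)) n) \<in> borel_measurable M"
proof (induction p arbitrary: n)
  case (pCons a p)
  note [measurable] = pCons.IH measurable_int_iterate[OF T]
  have "(\<lambda>\<omega>. coord (blinfun_apply (poly_op (pCons a p) (hamiltonian M T f \<omega>)) (delta m)) n) \<in> borel_measurable M
    \<longleftrightarrow> (\<lambda>\<omega>. complex_of_real a * coord (delta m) n
      + (coord (blinfun_apply (poly_op p (hamiltonian M T f \<omega>)) (delta m)) (n - 1)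
       + coord (blinfun_apply (poly_op p (hamiltonian M T f \<omega>)) (delta m)) (n + 1)
       + complex_of_real (f (int_iterate M T n \<omega>))
          * coord (blinfun_apply (poly_op p (hamiltonian M T f \<omega>)) (delta m)) n)) \<in> borel_measurable M"
    by (rule measurable_cong) (simp add: hamiltonian_def coord_schroedinger[OF bd])
  also have "\<dots>" by measurable
  finally show ?case .
qed simp

section \<open>Limits along the orbits of the transformation\<close>

locale hamiltonian_family =
  fixes M :: "'a measure" and T :: "'a \<Rightarrow> 'a" and f :: "'a \<Rightarrow> real" and C :: real
  assumes invertible: "invertible_map M T"
    and f_measurable: "f \<in> borel_measurable M"
    and f_le: "\<omega> \<in> space M \<Longrightarrow> \<bar>f \<omega>\<bar> \<le> C"
begin

definition orbit :: "'a \<Rightarrow> int \<Rightarrow> real" where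
  "orbit \<omega> n = f (int_iterate M T n \<omega>)"

lemma hamiltonian_eq: "hamiltonian M T f \<omega> = schroedinger (orbit \<omega>)"
  by (simp add: hamiltonian_def orbit_def[abs_def])

lemma bounded_potential_orbit: "\<omega> \<in> space M \<Longrightarrow> bounded_potential (orbit \<omega>) C"
  using f_le measurable_space[OF measurable_int_iterate[OF invertible]]
  by (simp add: bounded_potential_def orbit_def)

lemma orbit_step: "\<omega> \<in> space M \<Longrightarrow> orbit (T \<omega>) = (\<lambda>n. orbit \<omega> (n + 1))"
  by (simp add: orbit_def[abs_def] int_iterate_step[OF invertible])

definition low :: "(real \<Rightarrow> real) \<Rightarrow> sign \<Rightarrow> 'a \<Rightarrow> ereal" where
  "low g s \<omega> = liminf (\<lambda>N. ereal (\<integral>x. g x \<partial>dk (hamiltonian M T f \<omega>) s N))"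

definition high :: "(real \<Rightarrow> real) \<Rightarrow> sign \<Rightarrow> 'a \<Rightarrow> ereal" where
  "high g s \<omega> = limsup (\<lambda>N. ereal (\<integral>x. g x \<partial>dk (hamiltonian M T f \<omega>) s N))"

text \<open>Moving along the orbit translates the potential by one site, which changes the averages
  by a null sequence.\<close>

lemma low_high_step:
  assumes "\<omega> \<in> space M"
  shows "low (poly p) s (T \<omega>) = low (poly p) s \<omega>" and "high (poly p) s (T \<omega>) = high (poly p) s \<omega>"
  unfolding low_def high_def hamiltonian_eq orbit_step[OF assms]
  using liminf_limsup_eq_of_diff[OF integral_dk_poly_shift[OF bounded_potential_orbit[OF assms]]]
  by simp_all

text \<open>Lengths are written as \<open>Suc N\<close> since the measure for length 0 is
  unspecified; dropping the first term leaves upper and lower limits unchanged.\<close>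

lemma measurable_integral_dk_poly:
  "(\<lambda>\<omega>. \<integral>x. poly p x \<partial>dk (hamiltonian M T f \<omega>) s (Suc N)) \<in> borel_measurable M"
proof -
  have "bounded (range (\<lambda>n. f (int_iterate M T n \<omega>)))" if "\<omega> \<in> space M" for \<omega>
    using bounded_potential.bounded_V[OF bounded_potential_orbit[OF that]]
    by (simp add: orbit_def[abs_def])
  note [measurable] = measurable_coord_poly_op_hamiltonian[OF invertible f_measurable this]
  have "(\<lambda>\<omega>. \<integral>x. poly p x \<partial>dk (hamiltonian M T f \<omega>) s (Suc N)) \<in> borel_measurable M
    \<longleftrightarrow> (\<lambda>\<omega>. (\<Sum>n\<in>window s (Suc N). Re (coord (blinfun_apply (poly_op p (hamiltonian M T f \<omega>)) (delta n)) n))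
          / real (Suc N)) \<in> borel_measurable M"
    by (rule measurable_cong)
      (simp add: hamiltonian_eq bounded_potential.integral_dk_poly[OF bounded_potential_orbit]
        bounded_potential.site_def[OF bounded_potential_orbit] inner_delta)
  also have "\<dots>" by measurable
  finally show ?thesis .
qed

lemma measurable_low_high:
  "low (poly p) s \<in> borel_measurable M" "high (poly p) s \<in> borel_measurable M"
proof -
  note [measurable] = measurable_integral_dk_poly
  have "low (poly p) s = (\<lambda>\<omega>. liminf (\<lambda>N. ereal (\<integral>x. poly p x \<partial>dk (hamiltonian M T f \<omega>) s (Suc N))))"
    unfolding low_def[abs_def] Suc_eq_plus1 by (intro ext liminf_shift[symmetric])
  then show "low (poly p) s \<in> borel_measurable M" by simp
  have "high (poly p) s = (\<lambda>\<omega>. limsup (\<lambda>N. ereal (\<integral>x. poly p x \<partial>dk (hamiltonian M T f \<omega>) s (Suc N))))"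
    unfolding high_def[abs_def] Suc_eq_plus1 by (intro ext limsup_shift[symmetric])
  then show "high (poly p) s \<in> borel_measurable M" by simp
qed

lemma low_high_finite:
  assumes "\<omega> \<in> space M" "continuous_on UNIV g"
  shows "\<bar>low g s \<omega>\<bar> \<noteq> \<infinity>" and "\<bar>high g s \<omega>\<bar> \<noteq> \<infinity>"
proof -
  interpret bounded_potential "orbit \<omega>" C by (rule bounded_potential_orbit) fact
  obtain c where "\<And>x. x \<in> {- (2 + C)..2 + C} \<Longrightarrow> \<bar>g x\<bar> \<le> c"
    using continuous_bounded_on_interval[OF assms(2)] by blast
  then have "\<bar>\<integral>x. g x \<partial>dk (schroedinger (orbit \<omega>)) s N\<bar> \<le> c" if "0 < N" for N
    by (intro integral_dk_abs_le that assms(2)) blast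
  from liminf_limsup_finite[OF this] show "\<bar>low g s \<omega>\<bar> \<noteq> \<infinity>" "\<bar>high g s \<omega>\<bar> \<noteq> \<infinity>"
    by (simp_all add: low_def high_def hamiltonian_eq)
qed

lemma low_high_perturb:
  assumes "\<omega> \<in> space M" "continuous_on UNIV g" "continuous_on UNIV h"
    and "\<And>x. x \<in> {- (2 + C)..2 + C} \<Longrightarrow> \<bar>g x - h x\<bar> \<le> e"
  shows "low g s \<omega> \<le> low h s \<omega> + ereal e" and "high g s \<omega> \<le> high h s \<omega> + ereal e"
proof -
  interpret bounded_potential "orbit \<omega>" C by (rule bounded_potential_orbit) fact
  have "(\<integral>x. g x \<partial>dk (schroedinger (orbit \<omega>)) s N) \<le> (\<integral>x. h x \<partial>dk (schroedinger (orbit \<omega>)) s N) + e"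
    if "0 < N" for N
    using integral_dk_diff_le[OF that assms(2-4), of s] by linarith
  from liminf_limsup_le_add[OF this]
  show "low g s \<omega> \<le> low h s \<omega> + ereal e" "high g s \<omega> \<le> high h s \<omega> + ereal e"
    by (simp_all add: low_def high_def hamiltonian_eq)
qed

text \<open>Approximate \<open>g\<close> by a rational polynomial within \<open>e / 2\<close> on the
  common interval, pass from one point to the other there, and return to \<open>g\<close>.
  Exchanging the two points gives equality.\<close>

lemma low_high_le:
  assumes \<omega>: "\<omega> \<in> space M" "\<omega>' \<in> space M" and g: "continuous_on UNIV g"
    and eq: "\<And>l. low (poly (rat_poly l)) s \<omega> = low (poly (rat_poly l)) s \<omega>'"
      "\<And>l. high (poly (rat_poly l)) s \<omega> = high (poly (rat_poly l)) s \<omega>'"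
  shows "low g s \<omega> \<le> low g s \<omega>'" and "high g s \<omega> \<le> high g s \<omega>'"
proof -
  interpret bounded_potential "orbit \<omega>" C by (rule bounded_potential_orbit) fact
  have "low g s \<omega> \<le> low g s \<omega>' + ereal e \<and> high g s \<omega> \<le> high g s \<omega>' + ereal e" if "0 < e" for e
  proof -
    from that have e: "0 < e / 4" by simp
    obtain p where p: "\<And>x. x \<in> {- (2 + C)..2 + C} \<Longrightarrow> \<bar>g x - poly p x\<bar> < e / 4"
      using real_poly_uniform_approx[OF continuous_on_subset[OF g] e] by (metis subset_UNIV)
    obtain l where l: "\<And>x. x \<in> {- (2 + C)..2 + C} \<Longrightarrow> \<bar>poly p x - poly (rat_poly l) x\<bar> < e / 4"
      using rat_poly_approx[OF e, of "2 + C" p] C_nonneg by (metis add_nonneg_nonneg zero_le_numeral)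
    let ?h = "poly (rat_poly l)"
    have h: "continuous_on UNIV ?h" by (intro continuous_intros)
    have d: "\<bar>g x - ?h x\<bar> \<le> e / 2" "\<bar>?h x - g x\<bar> \<le> e / 2" if "x \<in> {- (2 + C)..2 + C}" for x
      using p[OF that] l[OF that] by linarith+
    have half: "y + ereal (e / 2) + ereal (e / 2) = y + ereal e" for y
      by (simp add: add.assoc)
    have "low g s \<omega> \<le> low ?h s \<omega>' + ereal (e / 2)" "high g s \<omega> \<le> high ?h s \<omega>' + ereal (e / 2)"
      using low_high_perturb[OF \<omega>(1) g h d(1), of s] by (simp_all add: eq)
    moreover have "low ?h s \<omega>' \<le> low g s \<omega>' + ereal (e / 2)" "high ?h s \<omega>' \<le> high g s \<omega>' + ereal (e / 2)"
      by (rule low_high_perturb[OF \<omega>(2) h g d(2)]; simp)+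
    ultimately have "low g s \<omega> \<le> low g s \<omega>' + ereal (e / 2) + ereal (e / 2)"
      "high g s \<omega> \<le> high g s \<omega>' + ereal (e / 2) + ereal (e / 2)"
      by (blast intro: order_trans add_right_mono)+
    then show ?thesis by (simp only: half simp_thms)
  qed
  then show "low g s \<omega> \<le> low g s \<omega>'" "high g s \<omega> \<le> high g s \<omega>'"
    by - (rule ereal_le_epsilon2, blast)+
qed

lemma low_high_tilde:
  assumes "\<omega> \<in> space M" "continuous_on UNIV g"
  shows "liminf (\<lambda>N. ereal (\<integral>x. g x \<partial>dk_tilde (hamiltonian M T f \<omega>) s N)) = low g s \<omega>"
    and "limsup (\<lambda>N. ereal (\<integral>x. g x \<partial>dk_tilde (hamiltonian M T f \<omega>) s N)) = high g s \<omega>"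
  unfolding low_def high_def hamiltonian_eq
  using liminf_limsup_eq_of_diff[OF bounded_potential.integral_dk_tilde_diff[OF bounded_potential_orbit[OF assms(1)] assms(2)]]
  by simp_all

end

theorem theorem5p3:
  fixes M :: "'a measure" and T :: "'a \<Rightarrow> 'a" and f :: "'a \<Rightarrow> real"
  assumes "sigma_finite_measure M"
    and "emeasure M (space M) = \<infinity>"
    and "conservative_map M T"
    and "invertible_map M T"
    and "ergodic_map M T"
    and "preserves_measure M T"
    and "f \<in> borel_measurable M"
    and "bounded (f ` space M)"
  shows "\<exists>\<Omega>s\<in>sets M. emeasure M (space M - \<Omega>s) = 0 \<and>
    (\<forall>g :: real \<Rightarrow> real. continuous_on UNIV g \<longrightarrow>
      (\<exists>I_sup I_inf :: sign \<Rightarrow> real. \<forall>\<omega>\<in>\<Omega>s. \<forall>s.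
        liminf (\<lambda>N. ereal (\<integral>x. g x \<partial>dk (hamiltonian M T f \<omega>) s N)) = ereal (I_inf s) \<and>
        liminf (\<lambda>N. ereal (\<integral>x. g x \<partial>dk_tilde (hamiltonian M T f \<omega>) s N)) = ereal (I_inf s) \<and>
        limsup (\<lambda>N. ereal (\<integral>x. g x \<partial>dk (hamiltonian M T f \<omega>) s N)) = ereal (I_sup s) \<and>
        limsup (\<lambda>N. ereal (\<integral>x. g x \<partial>dk_tilde (hamiltonian M T f \<omega>) s N)) = ereal (I_sup s)))"
proof -
  from assms(8) obtain C where "\<forall>y\<in>f ` space M. \<bar>y\<bar> \<le> C" unfolding bounded_iff by auto
  then interpret hamiltonian_family M T f C
    using assms by unfold_locales auto
  have "\<exists>d. AE \<omega> in M. low (poly (rat_poly l)) s \<omega> = d" "\<exists>d. AE \<omega> in M. high (poly (rat_poly l)) s \<omega> = d" for l s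
    by (intro ergodic_imp_AE_const[OF assms(5)] measurable_low_high low_high_step; assumption)+
  then obtain d d' where "\<And>l s. AE \<omega> in M. low (poly (rat_poly l)) s \<omega> = d l s"
    "\<And>l s. AE \<omega> in M. high (poly (rat_poly l)) s \<omega> = d' l s"
    by metis
  \<comment> \<open>The two signs are listed explicitly, while the countable quantifier ranges over
    the coefficient lists.\<close>
  then have "AE \<omega> in M. \<forall>l. (low (poly (rat_poly l)) Plus \<omega> = d l Plus \<and> high (poly (rat_poly l)) Plus \<omega> = d' l Plus)
      \<and> (low (poly (rat_poly l)) Minus \<omega> = d l Minus \<and> high (poly (rat_poly l)) Minus \<omega> = d' l Minus)"
    unfolding AE_all_countable by (intro allI AE_conjI)
  then obtain Z where Z: "Z \<in> sets M" "emeasure M Z = 0" and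
    const': "\<And>\<omega> l. \<omega> \<in> space M - Z \<Longrightarrow> (low (poly (rat_poly l)) Plus \<omega> = d l Plus \<and> high (poly (rat_poly l)) Plus \<omega> = d' l Plus)
      \<and> (low (poly (rat_poly l)) Minus \<omega> = d l Minus \<and> high (poly (rat_poly l)) Minus \<omega> = d' l Minus)"
    by (elim AE_E) blast
  have const: "low (poly (rat_poly l)) s \<omega> = d l s" "high (poly (rat_poly l)) s \<omega> = d' l s"
    if "\<omega> \<in> space M - Z" for \<omega> l s
    using const'[OF that, of l] by (cases s; simp)+
  show ?thesis
  proof (intro bexI[of _ "space M - Z"] conjI allI impI)
    show "emeasure M (space M - (space M - Z)) = 0"
      using Z sets.sets_into_space[OF Z(1)] by (simp add: double_diff)
    show "space M - Z \<in> sets M" using Z by auto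
    fix g :: "real \<Rightarrow> real" assume g: "continuous_on UNIV g"
    \<comment> \<open>A reference point whose limits serve as the constants. Its membership is
      derived only after some point outside \<open>Z\<close> has been fixed, which provides the
      witness for the choice.\<close>
    define \<omega>0 where "\<omega>0 = (SOME \<omega>. \<omega> \<in> space M - Z)"
    show "\<exists>I_sup I_inf :: sign \<Rightarrow> real. \<forall>\<omega>\<in>space M - Z. \<forall>s.
        liminf (\<lambda>N. ereal (\<integral>x. g x \<partial>dk (hamiltonian M T f \<omega>) s N)) = ereal (I_inf s) \<and>
        liminf (\<lambda>N. ereal (\<integral>x. g x \<partial>dk_tilde (hamiltonian M T f \<omega>) s N)) = ereal (I_inf s) \<and>
        limsup (\<lambda>N. ereal (\<integral>x. g x \<partial>dk (hamiltonian M T f \<omega>) s N)) = ereal (I_sup s) \<and>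
        limsup (\<lambda>N. ereal (\<integral>x. g x \<partial>dk_tilde (hamiltonian M T f \<omega>) s N)) = ereal (I_sup s)"
    proof (rule exI[of _ "\<lambda>s. real_of_ereal (high g s \<omega>0)"], rule exI[of _ "\<lambda>s. real_of_ereal (low g s \<omega>0)"], intro ballI allI)
      fix \<omega> s assume \<omega>: "\<omega> \<in> space M - Z"
      then have \<omega>0: "\<omega>0 \<in> space M - Z" unfolding \<omega>0_def by (rule someI)
      have "low g s \<alpha> \<le> low g s \<beta>" "high g s \<alpha> \<le> high g s \<beta>"
        if "\<alpha> \<in> space M - Z" "\<beta> \<in> space M - Z" for \<alpha> \<beta>
        by (rule low_high_le[OF _ _ g]; use that in \<open>simp add: const\<close>)+
      then have "low g s \<omega> = low g s \<omega>0" "high g s \<omega> = high g s \<omega>0"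
        using \<omega> \<omega>0 by (blast intro: antisym)+
      then have "low g s \<omega> = ereal (real_of_ereal (low g s \<omega>0))" "high g s \<omega> = ereal (real_of_ereal (high g s \<omega>0))"
        using low_high_finite[OF _ g] \<omega>0 by (simp_all add: ereal_real)
      then show "liminf (\<lambda>N. ereal (\<integral>x. g x \<partial>dk (hamiltonian M T f \<omega>) s N)) = ereal (real_of_ereal (low g s \<omega>0)) \<and>
        liminf (\<lambda>N. ereal (\<integral>x. g x \<partial>dk_tilde (hamiltonian M T f \<omega>) s N)) = ereal (real_of_ereal (low g s \<omega>0)) \<and>
        limsup (\<lambda>N. ereal (\<integral>x. g x \<partial>dk (hamiltonian M T f \<omega>) s N)) = ereal (real_of_ereal (high g s \<omega>0)) \<and>
        limsup (\<lambda>N. ereal (\<integral>x. g x \<partial>dk_tilde (hamiltonian M T f \<omega>) s N)) = ereal (real_of_ereal (high g s \<omega>0))"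
        using low_high_tilde[OF _ g, of \<omega> s] \<omega> unfolding low_def[symmetric] high_def[symmetric] by simp
    qed
  qed
qed

end
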